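(* Let $X$ be a Banach space such that the unit ball of $X^*$ is weak$^*$-separable. If $\phi:[0,1]\to X$ is McShane integrable and $\overline{\int}\|\phi(s)\|\,\mu(ds)<\infty$, then $\phi$ is Talagrand integrable.
   Context: Banach spaces are real; $X^*$ is the dual of $X$. $\mu$ is Lebesgue measure on $[0,1]$. For $g:[0,1]\to[0,\infty)$, the upper integral $\overline{\int}g\,d\mu$ is the infimum of $\int h\,d\mu$ over Lebesgue integrable $h\ge g$ ($\infty$ if there is no such $h$). Intervals are non-overlapping if their interiors are pairwise disjoint. McShane integral: A McShane partition of $[0,1]$ is a finite sequence $\langle([a_i,b_i],t_i)\rangle_{i\le n}$ such that $\langle[a_i,b_i]\rangle_{i\le n}$ is a non-overlapping family of closed intervals covering $[0,1]$ (i.e. with union $[0,1]$) and $t_i\in[0,1]$ for each $i$ (it is not required that $t_i\in[a_i,b_i]$). A gauge on $[0,1]$ is a function $\delta:[0,1]\to(0,\infty)$. The partition is subordinate to $\delta$ if $t_i-\delta(t_i)\le a_i\le b_i\le t_i+\delta(t_i)$ for every $i\le n$. A function $\phi:[0,1]\to X$ is McShane integrable, with McShane integral $w\in X$, if for every $\epsilon>0$ there is a gauge $\delta$ such that $\|w-\sum_{i\le n}(b_i-a_i)\phi(t_i)\|\le\epsilon$ for every McShane partition $\langle([a_i,b_i],t_i)\rangle_{i\le n}$ of $[0,1]$ subordinate to $\delta$. Talagrand integral: $\phi:[0,1]\to X$ is Talagrand integrable, with Talagrand integral $w\in X$, if $w=\lim_{n\to\infty}\frac1n\sum_{i<n}\phi(s_i)$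 (norm limit) for almost all sequences $\langle s_i\rangle_{i\in\mathbb N}\in[0,1]^{\mathbb N}$, where $[0,1]^{\mathbb N}$ is given the product probability measure of copies of $\mu$. *)

theory Defs
  imports "HOL-Probability.Probability"
begin

(* The topology strong_operator_topology on operators into the reals is the topology of
   pointwise convergence on X, i.e. the weak* topology of the dual X*; the unit ball is
   taken with respect to the dual (operator) norm. *)
definition weak_star_separable_dual_ball :: "'a::real_normed_vector itself \<Rightarrow> bool" where
  "weak_star_separable_dual_ball _ \<longleftrightarrow>
     separable_space (subtopology strong_operator_topology (cball (0 :: 'a \<Rightarrow>\<^sub>L real) 1))"

(* Functions on [0,1] are represented by functions on the reals; the definitions below
   depend only on their values on [0,1]. *)

(* The value is top if no integrable function dominates g, since Inf {} = top. *)
definition upper_integral01 :: "(real \<Rightarrow> real) \<Rightarrow> ennreal" where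
  "upper_integral01 g =
     Inf {ennreal (integral\<^sup>L (lebesgue_on {0..1}) h) | h.
            integrable (lebesgue_on {0..1}) h \<and> (\<forall>s\<in>{0..1}. g s \<le> h s)}"

(* An entry ((a, b), t) is the closed interval [a, b] with tag t. Disjointness of interiors is
   required for distinct indices, so an interval of positive length cannot be repeated. *)
definition mcshane_partition :: "((real \<times> real) \<times> real) list \<Rightarrow> bool" where
  "mcshane_partition p \<longleftrightarrow>
     (\<forall>((a, b), t) \<in> set p. a \<le> b \<and> t \<in> {0..1}) \<and>
     (\<forall>i<length p. \<forall>j<length p. i \<noteq> j \<longrightarrow>
        interior {fst (fst (p ! i))..snd (fst (p ! i))} \<inter>
        interior {fst (fst (p ! j))..snd (fst (p ! j))} = {}) \<and>
     (\<Union>((a, b), t) \<in> set p. {a..b}) = {0..1}"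

definition mcshane_gauge :: "(real \<Rightarrow> real) \<Rightarrow> bool" where
  "mcshane_gauge \<delta> \<longleftrightarrow> (\<forall>t\<in>{0..1}. 0 < \<delta> t)"

definition subordinate :: "((real \<times> real) \<times> real) list \<Rightarrow> (real \<Rightarrow> real) \<Rightarrow> bool" where
  "subordinate p \<delta> \<longleftrightarrow> (\<forall>((a, b), t) \<in> set p. t - \<delta> t \<le> a \<and> a \<le> b \<and> b \<le> t + \<delta> t)"

definition mcshane_sum :: "(real \<Rightarrow> 'a::real_vector) \<Rightarrow> ((real \<times> real) \<times> real) list \<Rightarrow> 'a" where
  "mcshane_sum \<phi> p = (\<Sum>((a, b), t)\<leftarrow>p. (b - a) *\<^sub>R \<phi> t)"

definition has_mcshane_integral :: "(real \<Rightarrow> 'a::real_normed_vector) \<Rightarrow> 'a \<Rightarrow> bool" where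
  "has_mcshane_integral \<phi> w \<longleftrightarrow>
     (\<forall>\<epsilon>>0. \<exists>\<delta>. mcshane_gauge \<delta> \<and>
        (\<forall>p. mcshane_partition p \<and> subordinate p \<delta> \<longrightarrow> norm (w - mcshane_sum \<phi> p) \<le> \<epsilon>))"

definition mcshane_integrable :: "(real \<Rightarrow> 'a::real_normed_vector) \<Rightarrow> bool" where
  "mcshane_integrable \<phi> \<longleftrightarrow> (\<exists>w. has_mcshane_integral \<phi> w)"

(* The product measure is not completed, which is immaterial here: AE only asks that the
   exceptional set be contained in a measurable null set. *)
definition has_talagrand_integral :: "(real \<Rightarrow> 'a::real_normed_vector) \<Rightarrow> 'a \<Rightarrow> bool" where
  "has_talagrand_integral \<phi> w \<longleftrightarrow>
     (AE s in PiM (UNIV :: nat set) (\<lambda>_. lebesgue_on {0..1}).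
        (\<lambda>n. (1 / real n) *\<^sub>R (\<Sum>i<n. \<phi> (s i))) \<longlonglongrightarrow> w)"

definition talagrand_integrable :: "(real \<Rightarrow> 'a::real_normed_vector) \<Rightarrow> bool" where
  "talagrand_integrable \<phi> \<longleftrightarrow> (\<exists>w. has_talagrand_integral \<phi> w)"

end

(* The function \<open>\<phi>\<close> need not be measurable, so the law of large numbers is applied only to scalar functions.
   Let \<open>\<delta>\<close> be a gauge for the McShane integral \<open>w\<close> and take \<open>k\<close> so large that
   \<open>A = {t. 1/k \<le> \<delta> t}\<close> has outer measure near 1; let \<open>E\<close> be a measurable hull of \<open>A\<close>.
   For a sequence \<open>s\<close> that is equidistributed and avoids \<open>E - A\<close>, the points \<open>s i\<close> in \<open>E\<close> (\<open>i < n\<close>)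
   serve as tags of disjoint intervals of length about \<open>1/n\<close>, chosen within the \<open>k\<close> bins of length \<open>1/k\<close>;
   the small remainder of [0,1] is filled with a Henstock partition, and what it and the points outside
   \<open>E\<close> contribute is controlled by an integrable majorant of \<open>norm \<circ> \<phi>\<close>. Hence the averages are
   eventually close to \<open>w\<close>. Sequences avoiding \<open>E - A\<close> form a set of full outer measure only, but the
   event "eventually close" is measurable, because the norm is a supremum of countably many functionals \<open>f\<close>
   (Hahn-Banach and weak* separability) and each \<open>f \<circ> \<phi>\<close> is measurable; so the event is conull. *)

theory Submission
  imports Defs
begin

section \<open>The strong law of large numbers\<close>

lemma distr_shift_PiM:
  assumes "prob_space M"
  shows "distr (PiM (UNIV::nat set) (\<lambda>_. M)) (PiM UNIV (\<lambda>_. M)) (\<lambda>s i. s (Suc i)) = PiM UNIV (\<lambda>_. M)"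
proof -
  interpret prob_space M by fact
  interpret sequence_space M ..
  show ?thesis
    using distr_PiM_reindex[of UNIV "\<lambda>_. M" Suc UNIV] assms
    by (simp add: restrict_UNIV)
qed

text \<open>Garsia's argument: the maxima \<open>m n\<close> of the first \<open>n\<close> partial sums (and \<open>0\<close>) are integrable and
  nondecreasing in \<open>n\<close>, so \<open>m (n+1) - m n \<circ> T\<close> has nonnegative integral over the shift invariant event
  \<open>B\<close> that they are unbounded, while it tends to \<open>f (s 0)\<close> there. As \<open>B\<close> is independent of
  \<open>s 0\<close>, this gives \<open>0 \<le> P(B) * integral f\<close>.\<close>
lemma AE_partial_sums_bounded_above:
  fixes f :: "'a \<Rightarrow> real"
  assumes "prob_space M" and f: "integrable M f" and neg: "integral\<^sup>L M f < 0"
  shows "AE s in PiM (UNIV::nat set) (\<lambda>_. M). \<exists>c. \<forall>n. (\<Sum>i<n. f (s i)) \<le> c"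
proof -
  interpret prob_space M by fact
  interpret sequence_space M ..
  interpret MS: pair_sigma_finite M S ..
  define T where "T = (\<lambda>(s::nat\<Rightarrow>'a) i. s (Suc i))"
  have T[measurable]: "T \<in> measurable S S" unfolding T_def by (rule measurable_PiM_single') (auto simp: space_PiM)
  have distrT: "distr S S T = S" unfolding T_def using distr_shift_PiM[OF assms(1)] .
  \<comment> \<open>The recursion peels off the first entry: the nonempty partial sums of
    \<open>s\<close> up to length \<open>n + 1\<close> are \<open>f (s 0)\<close> plus the partial
    sums of \<open>T s\<close> up to length \<open>n\<close>, the empty one included.\<close>
  define m where "m = rec_nat (\<lambda>s. 0::real) (\<lambda>n r s. max 0 (f (s 0) + r (T s)))"
  have m0: "m 0 s = 0" and mS: "m (Suc n) s = max 0 (f (s 0) + m n (T s))" for n s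
    by (simp_all add: m_def)
  have fm[measurable]: "f \<in> borel_measurable M" using f by simp
  have mm[measurable]: "m n \<in> borel_measurable S" for n
  proof (induction n)
    case (Suc n)
    then have [measurable]: "m n \<in> borel_measurable S" .
    have "(\<lambda>s. max 0 (f (s 0) + m n (T s))) \<in> borel_measurable S" by measurable
    then show ?case by (simp add: mS[abs_def])
  qed (simp add: m0[abs_def])
  have m_nonneg: "0 \<le> m n s" for n s by (cases n) (auto simp: m0 mS)
  have m_mono: "m n s \<le> m (Suc n) s" for n s
  proof (induction n arbitrary: s)
    case 0 then show ?case using m_nonneg by (simp add: m0)
  next
    case (Suc n)
    have "m n (T s) \<le> m (Suc n) (T s)" by (rule Suc)
    then show ?case unfolding mS[of n s] mS[of "Suc n" s] by (intro max.mono add_mono) auto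
  qed
  have incm: "incseq (\<lambda>n. m n s)" for s by (rule incseq_SucI) (rule m_mono)
  have sum_le: "(\<Sum>i<n. f (s i)) \<le> m n s" for n s
  proof (induction n arbitrary: s)
    case (Suc n)
    have "(\<Sum>i<Suc n. f (s i)) = f (s 0) + (\<Sum>i<n. f (T s i))"
      unfolding T_def by (rule sum.lessThan_Suc_shift)
    then show ?case using Suc[of "T s"] by (simp add: mS)
  qed (simp add: m0)
  define B where "B = {s \<in> space S. \<forall>c::nat. \<exists>n. real c < m n s}"
  have B[measurable]: "B \<in> sets S" unfolding B_def by measurable
  \<comment> \<open>Dropping the first entry changes the maxima, up to a shift of the index, by at
    most \<open>|f (s 0)|\<close>, so unboundedness is unaffected.\<close>
  have TB: "T s \<in> B \<longleftrightarrow> s \<in> B" if s: "s \<in> space S" for s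
  proof -
    have Ts: "T s \<in> space S" using measurable_space[OF T s] .
    have "s \<in> B" if "T s \<in> B"
      unfolding B_def
    proof (safe intro!: s)
      fix c :: nat
      obtain d :: nat where d: "real c + \<bar>f (s 0)\<bar> < real d" using reals_Archimedean2 by blast
      obtain n where "real d < m n (T s)" using \<open>T s \<in> B\<close> unfolding B_def by blast
      then have "real c < m (Suc n) s" using d by (simp add: mS)
      then show "\<exists>n. real c < m n s" ..
    qed
    moreover have "T s \<in> B" if "s \<in> B"
      unfolding B_def
    proof (safe intro!: Ts)
      fix c :: nat
      obtain d :: nat where d: "real c + \<bar>f (s 0)\<bar> < real d" using reals_Archimedean2 by blast
      obtain n where "real d < m n s" using \<open>s \<in> B\<close> unfolding B_def by blast
      then have "real d < m (Suc n) s" using m_mono[of n s] by linarith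
      then have "real c < m n (T s)" using d by (simp add: mS split: if_splits)
      then show "\<exists>n. real c < m n (T s)" ..
    qed
    ultimately show ?thesis by blast
  qed
  have f0: "integrable S (\<lambda>s. f (s 0))"
    using f PiM_component[of 0] integrable_distr_eq[of "\<lambda>s. s 0" S M f] by simp
  have int_T: "integrable S (\<lambda>s. g (T s))" if "integrable S g" for g :: "_ \<Rightarrow> real"
    using that integrable_distr[OF T, of g] distrT by simp
  have lint_T: "(\<integral>s. g (T s) \<partial>S) = integral\<^sup>L S g" if "g \<in> borel_measurable S" for g :: "_ \<Rightarrow> real"
    using integral_distr[OF T that] distrT by simp
  have mi: "integrable S (m n)" for n
  proof (induction n)
    case (Suc n)
    have "integrable S (\<lambda>s. max 0 (f (s 0) + m n (T s)))"
      using f0 int_T[OF Suc] by (intro integrable_max) auto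
    then show ?case by (simp add: mS[abs_def])
  qed (simp add: m0[abs_def])
  \<comment> \<open>The difference is \<open>max (f (s 0)) (- m n (T s))\<close>; as
    \<open>m n (T s) \<ge> 0\<close>, it lies between \<open>f (s 0)\<close> and
    \<open>max 0 (f (s 0))\<close>.\<close>
  have bnd: "norm (indicator B s * (m (Suc n) s - m n (T s))) \<le> \<bar>f (s 0)\<bar>" for n s
    using m_nonneg[of n "T s"] by (auto simp: mS indicator_def)
  have lim: "(\<lambda>n. indicator B s * (m (Suc n) s - m n (T s))) \<longlonglongrightarrow> indicator B s * f (s 0)"
    if s: "s \<in> space S" for s
  proof (cases "s \<in> B")
    case True
    then have "T s \<in> B" using TB[OF s] by simp
    obtain c :: nat where c: "\<bar>f (s 0)\<bar> < real c" using reals_Archimedean2 by blast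
    obtain N where N: "real c < m N (T s)" using \<open>T s \<in> B\<close> unfolding B_def by blast
    \<comment> \<open>Once \<open>m n (T s)\<close> exceeds \<open>|f (s 0)|\<close>, the truncation
      at 0 in the recursion is inactive.\<close>
    have "m (Suc n) s - m n (T s) = f (s 0)" if "n \<ge> N" for n
      using incseqD[OF incm that, of "T s"] N c by (simp add: mS)
    then show ?thesis
      by (intro tendsto_eventually) (auto simp: eventually_sequentially)
  qed simp
  have "(\<lambda>n. \<integral>s. indicator B s * (m (Suc n) s - m n (T s)) \<partial>S)
           \<longlonglongrightarrow> (\<integral>s. indicator B s * f (s 0) \<partial>S)"
    by (rule integral_dominated_convergence[where w="\<lambda>s. \<bar>f (s 0)\<bar>"])
       (use f0 bnd lim in \<open>auto\<close>)
  moreover have "0 \<le> (\<integral>s. indicator B s * (m (Suc n) s - m n (T s)) \<partial>S)" for n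
  proof -
    have i1: "integrable S (\<lambda>s. indicator B s * m n s)" for n
      using integrable_mult_indicator[OF B mi] by simp
    \<comment> \<open>Invariance of both \<open>B\<close> and the measure under \<open>T\<close>
      removes the shift from the integral; then monotonicity in \<open>n\<close> applies.\<close>
    have "(\<integral>s. indicator B s * m n (T s) \<partial>S) = (\<integral>s. indicator B (T s) * m n (T s) \<partial>S)"
      by (rule Bochner_Integration.integral_cong) (use TB in \<open>auto simp: indicator_def\<close>)
    also have "\<dots> = (\<integral>s. indicator B s * m n s \<partial>S)"
      using lint_T[of "\<lambda>s. indicator B s * m n s"] by simp
    also have "\<dots> \<le> (\<integral>s. indicator B s * m (Suc n) s \<partial>S)"
      by (rule integral_mono[OF i1 i1]) (use m_mono in \<open>auto simp: indicator_def\<close>)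
    finally have "(\<integral>s. indicator B s * m n (T s) \<partial>S) \<le> (\<integral>s. indicator B s * m (Suc n) s \<partial>S)" .
    moreover have "integrable S (\<lambda>s. indicator B s * m n (T s))"
      using integrable_mult_indicator[OF B int_T[OF mi]] by simp
    ultimately show ?thesis
      using i1[of "Suc n"] by (simp add: right_diff_distrib)
  qed
  ultimately have ge0: "0 \<le> (\<integral>s. indicator B s * f (s 0) \<partial>S)"
    by (meson LIMSEQ_le_const)
  \<comment> \<open>Independence of \<open>B\<close> and \<open>s 0\<close>: \<open>case_nat\<close>
    glues an independent first entry to a tail, and the tail alone decides membership in
    \<open>B\<close>, so Fubini factors the integral.\<close>
  have cn[measurable]: "(\<lambda>(x, \<omega>). case_nat x \<omega>) \<in> measurable (M \<Otimes>\<^sub>M S) S" by measurable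
  have iB: "integrable S (\<lambda>s. indicator B s * f (s 0))"
    using integrable_mult_indicator[OF B f0] by simp
  have caseB: "case_nat x \<omega> \<in> B \<longleftrightarrow> \<omega> \<in> B" if "x \<in> space M" "\<omega> \<in> space S" for x \<omega>
  proof -
    have "case_nat x \<omega> \<in> space S" using measurable_space[OF cn, of "(x,\<omega>)"] that by (simp add: space_pair_measure)
    moreover have "T (case_nat x \<omega>) = \<omega>" by (simp add: T_def)
    ultimately show ?thesis using TB by metis
  qed
  have iP: "integrable (M \<Otimes>\<^sub>M S) (\<lambda>(x,\<omega>). indicator B \<omega> * f x)"
  proof -
    have "integrable (M \<Otimes>\<^sub>M S) (\<lambda>p. indicator B (case p of (x, \<omega>) \<Rightarrow> case_nat x \<omega>) * f ((case p of (x, \<omega>) \<Rightarrow> case_nat x \<omega>) 0))"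
      using integrable_distr[OF cn, of "\<lambda>s. indicator B s * f (s 0)"] iB PiM_iter by simp
    then show ?thesis
      by (rule Bochner_Integration.integrable_cong[OF refl, THEN iffD1, rotated])
         (auto simp: space_pair_measure indicator_def caseB)
  qed
  have "(\<integral>s. indicator B s * f (s 0) \<partial>S) = (\<integral>p. indicator B (case p of (x, \<omega>) \<Rightarrow> case_nat x \<omega>) * f ((case p of (x, \<omega>) \<Rightarrow> case_nat x \<omega>) 0) \<partial>(M \<Otimes>\<^sub>M S))"
    by (subst PiM_iter[symmetric], subst integral_distr[OF cn]) (use PiM_iter in auto)
  also have "\<dots> = (\<integral>p. (case p of (x,\<omega>) \<Rightarrow> indicator B \<omega> * f x) \<partial>(M \<Otimes>\<^sub>M S))"
    by (rule Bochner_Integration.integral_cong) (auto simp: space_pair_measure indicator_def caseB)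
  also have "\<dots> = (\<integral>x. \<integral>\<omega>. indicator B \<omega> * f x \<partial>S \<partial>M)"
    using MS.integral_fst'[OF iP] by simp
  also have "\<dots> = measure S B * integral\<^sup>L M f" by (simp add: mult.commute)
  finally have "0 \<le> measure S B * integral\<^sup>L M f" using ge0 by simp
  then have "measure S B = 0" using neg
    by (metis linorder_not_less measure_nonneg mult_pos_neg order_le_less)
  then have "emeasure S B = 0" by (simp add: P.emeasure_eq_measure)
  then have "AE s in S. s \<notin> B" by (intro AE_not_in) (auto simp: null_sets_def)
  then show ?thesis
  proof (rule AE_mp, intro AE_I2 impI)
    fix s assume "s \<in> space S" "s \<notin> B"
    then obtain c :: nat where "\<forall>n. m n s \<le> real c" by (auto simp: B_def not_less)
    then have "\<forall>n. (\<Sum>i<n. f (s i)) \<le> real c" using sum_le order_trans by blast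
    then show "\<exists>c. \<forall>n. (\<Sum>i<n. f (s i)) \<le> c" ..
  qed
qed

text \<open>Partial sums of \<open>f - b\<close> that stay bounded above push the averages of
  \<open>f\<close> below every \<open>c > b\<close>; countably many \<open>b\<close> just above the
  integral serve all \<open>c\<close> with one null set. This is the upper half of the strong law,
  and all later applications ask for upper bounds only.\<close>

lemma AE_averages_eventually_less:
  fixes f :: "'a \<Rightarrow> real"
  assumes M: "prob_space M" and f: "integrable M f"
  shows "AE s in PiM (UNIV::nat set) (\<lambda>_. M). \<forall>c>integral\<^sup>L M f. eventually (\<lambda>n. (\<Sum>i<n. f (s i)) / real n < c) sequentially"
proof -
  interpret prob_space M by fact
  have "AE s in PiM (UNIV::nat set) (\<lambda>_. M). \<forall>k::nat. \<exists>C. \<forall>n. (\<Sum>i<n. f (s i) - (integral\<^sup>L M f + 1 / Suc k)) \<le> C"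
    unfolding AE_all_countable
  proof
    fix k :: nat
    show "AE s in PiM (UNIV::nat set) (\<lambda>_. M). \<exists>C. \<forall>n. (\<Sum>i<n. f (s i) - (integral\<^sup>L M f + 1 / Suc k)) \<le> C"
      by (rule AE_partial_sums_bounded_above[OF M]) (use f in \<open>simp_all add: prob_space\<close>)
  qed
  then show ?thesis
  proof (rule AE_mp, intro AE_I2 impI allI)
    fix s :: "nat \<Rightarrow> 'a" and c assume *: "\<forall>k::nat. \<exists>C. \<forall>n. (\<Sum>i<n. f (s i) - (integral\<^sup>L M f + 1 / Suc k)) \<le> C" and c: "integral\<^sup>L M f < c"
    obtain k :: nat where k: "inverse (real (Suc k)) < c - integral\<^sup>L M f" using reals_Archimedean[of "c - integral\<^sup>L M f"] c by auto
    define b where "b = integral\<^sup>L M f + 1 / Suc k"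
    have bc: "b < c" using k by (simp add: b_def inverse_eq_divide)
    obtain C where C: "\<And>n. (\<Sum>i<n. f (s i) - b) \<le> C" using * unfolding b_def by blast
    obtain n0 :: nat where n0: "\<bar>C\<bar> / (c - b) < real n0" using reals_Archimedean2 by blast
    have "(\<Sum>i<n. f (s i)) / real n < c" if n: "n \<ge> Suc n0" for n
    proof -
      have "\<bar>C\<bar> < real n0 * (c - b)" using n0 bc by (simp add: field_simps)
      also have "\<dots> \<le> real n * (c - b)" using n bc by (intro mult_right_mono) auto
      finally have "(\<Sum>i<n. f (s i)) < real n * c" using C[of n] by (simp add: sum_subtractf algebra_simps)
      then show ?thesis using n by (simp add: field_simps)
    qed
    then show "eventually (\<lambda>n. (\<Sum>i<n. f (s i)) / real n < c) sequentially"
      unfolding eventually_sequentially by blast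
  qed
qed

section \<open>Subsets of full outer measure\<close>

text \<open>For finite \<open>M\<close> this says that the complement of \<open>S\<close> has inner
  measure 0; \<open>S\<close> itself may be nonmeasurable.\<close>

definition full_outer :: "'a measure \<Rightarrow> 'a set \<Rightarrow> bool" where
  "full_outer M S \<longleftrightarrow> S \<subseteq> space M \<and> (\<forall>G\<in>sets M. S \<subseteq> G \<longrightarrow> emeasure M G = emeasure M (space M))"

text \<open>If \<open>G\<close> covers \<open>S \<inter> B\<close>, then \<open>G\<close> and the
  complement of \<open>B\<close> together cover \<open>S\<close>, hence have full measure, which
  leaves at least the measure of \<open>B\<close> to \<open>G\<close>.\<close>

lemma outer_measure_of_full_outer_Int:
  assumes "finite_measure M" "full_outer M S" "B \<in> sets M"
  shows "outer_measure_of M (S \<inter> B) = emeasure M B"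
proof (rule antisym)
  interpret finite_measure M by fact
  show "outer_measure_of M (S \<inter> B) \<le> emeasure M B"
    using outer_measure_of_mono[of "S \<inter> B" B M] assms(3) by simp
  show "emeasure M B \<le> outer_measure_of M (S \<inter> B)"
    unfolding outer_measure_of_def
  proof (rule INF_greatest, clarify)
    fix G assume G: "G \<in> sets M" "S \<inter> B \<subseteq> G"
    have "S \<subseteq> G \<union> (space M - B)" using assms(2) G by (auto simp: full_outer_def)
    then have "emeasure M (G \<union> (space M - B)) = emeasure M (space M)"
      using assms(2,3) G unfolding full_outer_def by blast
    then have "measure M (G \<union> (space M - B)) = measure M (space M)"
      by (simp add: measure_def)
    moreover have "measure M (G \<union> (space M - B)) \<le> measure M G + measure M (space M - B)"
      using G assms(3) by (intro measure_Un_le) auto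
    moreover have "measure M (space M - B) = measure M (space M) - measure M B"
      using assms(3) by (rule finite_measure_compl)
    ultimately show "emeasure M B \<le> emeasure M G" by (simp add: emeasure_eq_measure)
  qed
qed

text \<open>The measure is the trace of \<open>M\<close> on \<open>S\<close>: outer measure
  restricted to the sets \<open>S \<inter> B\<close> with \<open>B\<close> measurable. It lives on
  \<open>S\<close> although \<open>S\<close> may be nonmeasurable.\<close>

lemma full_outer_subspace_measure:
  assumes M: "prob_space M" and S: "full_outer M S"
  obtains \<nu> where "prob_space \<nu>" "space \<nu> = S" "(\<lambda>x. x) \<in> measurable \<nu> M" "distr \<nu> M (\<lambda>x. x) = M"
proof -
  interpret prob_space M by fact
  have Ssp: "S \<subseteq> space M" using S by (simp add: full_outer_def)
  have om: "outer_measure_of M (S \<inter> B) = emeasure M B" if "B \<in> sets M" for B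
    using outer_measure_of_full_outer_Int[OF _ S that] finite_measure_axioms by blast
  define \<nu> where "\<nu> = measure_of S ((\<inter>) S ` sets M) (outer_measure_of M)"
  have sa: "sigma_algebra S ((\<inter>) S ` sets M)"
    using sets.sigma_algebra_axioms[of "restrict_space M S"] Ssp
    by (simp add: sets_restrict_space space_restrict_space Int_absorb2)
  have sp: "space \<nu> = S" and se: "sets \<nu> = (\<inter>) S ` sets M"
    unfolding \<nu>_def using sa by (auto simp: sigma_algebra.sets_measure_of_eq sigma_algebra.space_measure_of_eq)
  have pos: "positive ((\<inter>) S ` sets M) (outer_measure_of M)"
    by (simp add: positive_def)
  have ca: "countably_additive ((\<inter>) S ` sets M) (outer_measure_of M)"
  proof (rule countably_additiveI)
    fix C :: "nat \<Rightarrow> 'a set" assume C: "range C \<subseteq> (\<inter>) S ` sets M" "disjoint_family C"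
    then have "\<forall>i. \<exists>B\<in>sets M. C i = S \<inter> B" by blast
    then obtain B where B: "\<And>i. B i \<in> sets M" "\<And>i. C i = S \<inter> B i" by metis
    have dB: "range (disjointed B) \<subseteq> sets M" using B(1) by (intro sets.range_disjointed_sets) auto
    \<comment> \<open>Since the traces are disjoint, cutting the earlier \<open>B j\<close> out of
      \<open>B i\<close> does not change the trace on \<open>S\<close>, so the \<open>B i\<close>
      may be taken disjoint.\<close>
    have C': "C i = S \<inter> disjointed B i" for i
    proof -
      have "C i \<inter> C j = {}" if "j < i" for j
        using C(2) that by (auto simp: disjoint_family_on_def)
      then have "x \<notin> B j" if "j < i" "x \<in> S" "x \<in> B i" for j x
        using that unfolding B(2) by blast
      then show ?thesis by (auto simp: B(2) disjointed_def)
    qed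
    have "(\<Union>i. C i) = S \<inter> (\<Union>i. disjointed B i)" using C' by auto
    then have "outer_measure_of M (\<Union>i. C i) = emeasure M (\<Union>i. disjointed B i)"
      using om dB by (simp add: image_subset_iff sets.countable_UN)
    also have "\<dots> = (\<Sum>i. emeasure M (disjointed B i))"
      by (rule suminf_emeasure[symmetric, OF dB disjoint_family_disjointed])
    also have "\<dots> = (\<Sum>i. outer_measure_of M (C i))"
      using om dB by (simp add: C' image_subset_iff)
    finally show "(\<Sum>i. outer_measure_of M (C i)) = outer_measure_of M (\<Union>i. C i)" ..
  qed
  have em: "emeasure \<nu> C = outer_measure_of M C" if "C \<in> sets \<nu>" for C
    using emeasure_measure_of_sigma[OF sa pos ca] that unfolding \<nu>_def[symmetric] se .
  have id: "(\<lambda>x. x) \<in> measurable \<nu> M"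
    by (rule measurableI) (use Ssp sp se in \<open>auto simp: Int_commute\<close>)
  have d: "distr \<nu> M (\<lambda>x. x) = M"
  proof (rule measure_eqI)
    fix B assume "B \<in> sets (distr \<nu> M (\<lambda>x. x))"
    then have B: "B \<in> sets M" by simp
    have "emeasure (distr \<nu> M (\<lambda>x. x)) B = emeasure \<nu> (S \<inter> B)"
      using emeasure_distr[OF id B] by (simp add: sp Int_commute)
    also have "\<dots> = emeasure M B" using em[of "S \<inter> B"] B om by (simp add: se)
    finally show "emeasure (distr \<nu> M (\<lambda>x. x)) B = emeasure M B" .
  qed simp
  have "prob_space \<nu>"
    using prob_space_distrD[OF id] d M by simp
  then show ?thesis using that sp id d by blast
qed

text \<open>In effect, sequences with values in \<open>S\<close> have full outer measure in the
  product. The product of the trace measures is carried by such sequences and is mapped onto the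
  product of \<open>M\<close> by the inclusion. So \<open>P\<close>, and with it \<open>Q\<close>,
  holds almost everywhere for the traces; measurability of \<open>Q\<close> lets this pass back to
  \<open>M\<close>.\<close>

lemma AE_PiM_full_outer:
  fixes M :: "'a measure"
  assumes M: "prob_space M" and S: "full_outer M S"
    and AE_P: "AE s in PiM (UNIV::nat set) (\<lambda>_. M). P s"
    and meas_Q: "{s \<in> space (PiM (UNIV::nat set) (\<lambda>_. M)). Q s} \<in> sets (PiM UNIV (\<lambda>_. M))"
    and PQ: "\<And>s. P s \<Longrightarrow> (\<And>i. s i \<in> S) \<Longrightarrow> Q s"
  shows "AE s in PiM (UNIV::nat set) (\<lambda>_. M). Q s"
proof -
  obtain \<nu> where \<nu>: "prob_space \<nu>" "space \<nu> = S" "(\<lambda>x. x) \<in> measurable \<nu> M" "distr \<nu> M (\<lambda>x. x) = M"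
    using full_outer_subspace_measure[OF M S] .
  interpret M: prob_space M by fact
  interpret sequence_space M ..
  let ?N = "PiM (UNIV::nat set) (\<lambda>_. \<nu>)"
  interpret N: prob_space \<nu> by fact
  interpret N: sequence_space \<nu> ..
  note \<nu>(3)[measurable]
  have id: "(\<lambda>s. s) \<in> measurable ?N (PiM UNIV (\<lambda>_. M))"
    by (rule measurable_PiM_single') (use measurable_space[OF \<nu>(3)] in \<open>auto simp: space_PiM\<close>)
  have d: "distr ?N (PiM UNIV (\<lambda>_. M)) (\<lambda>s. s) = PiM UNIV (\<lambda>_. M)"
  proof (rule PiM_eq)
    fix J :: "nat set" and F assume J: "finite J" "J \<subseteq> UNIV" "\<And>j. j \<in> J \<Longrightarrow> F j \<in> sets M"
    have FS: "F j \<inter> S \<in> sets \<nu>" "emeasure \<nu> (F j \<inter> S) = emeasure M (F j)" if "j \<in> J" for j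
      using measurable_sets[OF \<nu>(3) J(3)[OF that]] emeasure_distr[OF \<nu>(3) J(3)[OF that]]
      by (simp_all add: \<nu>)
    have "emeasure (distr ?N (PiM UNIV (\<lambda>_. M)) (\<lambda>s. s)) (prod_emb UNIV (\<lambda>_. M) J (Pi\<^sub>E J F))
        = emeasure ?N (prod_emb UNIV (\<lambda>_. M) J (Pi\<^sub>E J F) \<inter> space ?N)"
      using J by (subst emeasure_distr[OF id]) (auto intro!: sets_PiM_I)
    also have "prod_emb UNIV (\<lambda>_. M) J (Pi\<^sub>E J F) \<inter> space ?N
                = prod_emb UNIV (\<lambda>_. \<nu>) J (\<Pi>\<^sub>E j\<in>J. F j \<inter> S)"
    proof -
      have "(\<forall>i. x i \<in> S) \<longrightarrow> (\<forall>i. x i \<in> space M)" for x :: "nat \<Rightarrow> 'a"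
        using S by (auto simp: full_outer_def)
      then show ?thesis
        unfolding prod_emb_def space_PiM \<nu>(2) by (simp add: set_eq_iff restrict_PiE_iff PiE_UNIV_domain) blast
    qed
    also have "emeasure ?N \<dots> = (\<Prod>j\<in>J. emeasure \<nu> (F j \<inter> S))"
      using J FS by (intro N.emeasure_PiM_emb) auto
    also have "\<dots> = (\<Prod>j\<in>J. emeasure M (F j))" using FS by simp
    finally show "emeasure (distr ?N (PiM UNIV (\<lambda>_. M)) (\<lambda>s. s)) (prod_emb UNIV (\<lambda>_. M) J (Pi\<^sub>E J F))
        = (\<Prod>j\<in>J. emeasure M (F j))" .
  qed simp
  have "AE s in distr ?N (PiM UNIV (\<lambda>_. M)) (\<lambda>s. s). P s" unfolding d by (rule AE_P)
  then have "AE s in ?N. P s" by (rule AE_distrD[OF id])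
  then have "AE s in ?N. Q s"
  proof (rule AE_mp, intro AE_I2 impI)
    fix s assume "s \<in> space ?N" "P s"
    moreover from this(1) have "s i \<in> S" for i using \<nu>(2) by (auto simp: space_PiM)
    ultimately show "Q s" by (intro PQ)
  qed
  then have "AE s in distr ?N (PiM UNIV (\<lambda>_. M)) (\<lambda>s. s). Q s"
    by (subst AE_distr_iff[OF id meas_Q])
  then show ?thesis unfolding d .
qed

text \<open>\<open>E\<close> is a measurable hull of \<open>A\<close>: a measurable \<open>G\<close>
  above the union meets \<open>E\<close> in a cover of \<open>A\<close>, so it has the full measure
  of \<open>E\<close> there, and it contains the rest of the space.\<close>

lemma full_outer_Un_compl:
  assumes "finite_measure M" "E \<in> sets M" "A \<subseteq> E" "outer_measure_of M A = emeasure M E"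
  shows "full_outer M (A \<union> (space M - E))"
  unfolding full_outer_def
proof (intro conjI ballI impI)
  interpret finite_measure M by fact
  show "A \<union> (space M - E) \<subseteq> space M" using assms sets.sets_into_space by blast
  fix G assume G: "G \<in> sets M" "A \<union> (space M - E) \<subseteq> G"
  have "emeasure M (space M) = emeasure M (E \<union> (space M - E))"
    using sets.sets_into_space[OF assms(2)] by (simp add: Un_absorb1)
  also have "\<dots> = emeasure M E + emeasure M (space M - E)"
    using assms by (intro plus_emeasure[symmetric]) auto
  also have "emeasure M E \<le> emeasure M (G \<inter> E)"
    using outer_measure_of_mono[of A "G \<inter> E" M] assms G by simp
  also have "emeasure M (G \<inter> E) + emeasure M (space M - E) = emeasure M ((G \<inter> E) \<union> (space M - E))"
    using G assms by (intro plus_emeasure) auto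
  also have "\<dots> \<le> emeasure M G"
    using G by (intro emeasure_mono) auto
  finally show "emeasure M G = emeasure M (space M)"
    using emeasure_space[of M G] by (intro antisym) (auto simp: add_right_mono)
qed

section \<open>Norming functionals\<close>

definition sublinear :: "('a::real_vector \<Rightarrow> real) \<Rightarrow> bool" where
  "sublinear p \<longleftrightarrow> (\<forall>x y. p (x + y) \<le> p x + p y) \<and> (\<forall>c\<ge>0. \<forall>x. p (c *\<^sub>R x) = c * p x)"

lemma sublinearD:
  assumes "sublinear p"
  shows "p (x + y) \<le> p x + p y" "0 \<le> c \<Longrightarrow> p (c *\<^sub>R x) = c * p x" "p 0 = 0" "- p (- x) \<le> p x"
proof -
  have *: "p (x + y) \<le> p x + p y" "0 \<le> c \<Longrightarrow> p (c *\<^sub>R x) = c * p x" for x y c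
    using assms by (auto simp: sublinear_def)
  show "p (x + y) \<le> p x + p y" "0 \<le> c \<Longrightarrow> p (c *\<^sub>R x) = c * p x" using * by auto
  show "p 0 = 0" using *(2)[of 0 0] by simp
  then show "- p (- x) \<le> p x" using *(1)[of x "- x"] by simp
qed

text \<open>The inequality for the factor \<open>1/c\<close> is the reverse inequality for
  \<open>c\<close>.\<close>

lemma sublinearI:
  assumes "\<And>x y. p (x + y) \<le> p x + p y" "\<And>c x. 0 < c \<Longrightarrow> p (c *\<^sub>R x) \<le> c * p x" "p 0 = 0"
  shows "sublinear p"
  unfolding sublinear_def
proof (intro conjI allI impI)
  fix c :: real and x assume "0 \<le> c"
  show "p (c *\<^sub>R x) = c * p x"
  proof (cases "c = 0")
    case False
    with \<open>0 \<le> c\<close> have c: "0 < c" by simp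
    have "p ((1/c) *\<^sub>R (c *\<^sub>R x)) \<le> (1/c) * p (c *\<^sub>R x)" using c by (intro assms) simp
    then have "c * p x \<le> p (c *\<^sub>R x)" using c by (simp add: field_simps)
    then show ?thesis using assms(2)[OF c, of x] by simp
  qed (simp add: assms)
qed (use assms in auto)

lemma sublinear_norm: "sublinear norm"
  by (auto simp: sublinear_def norm_triangle_ineq)

text \<open>Take \<open>q y\<close> to be the infimum of
  \<open>p (y + t *\<^sub>R x) - t * p x\<close> over \<open>t \<ge> 0\<close>, which is bounded
  below by \<open>- p (- y)\<close>. The value \<open>t = 0\<close> gives \<open>q \<le> p\<close>,
  and \<open>t = 1\<close> gives the bound at \<open>- x\<close>.\<close>

lemma sublinear_decrease:
  fixes p :: "'a::real_vector \<Rightarrow> real"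
  assumes p: "sublinear p"
  obtains q where "sublinear q" "q \<le> p" "q (- x) \<le> - p x"
proof -
  note pD = sublinearD[OF p]
  define F where "F = (\<lambda>y t. p (y + t *\<^sub>R x) - t * p x)"
  define q where "q = (\<lambda>y. INF t\<in>{0..}. F y t)"
  have lb: "- p (- y) \<le> F y t" if "0 \<le> t" for y t
    using pD(1)[of "y + t *\<^sub>R x" "- y"] pD(2)[OF that, of x] by (simp add: F_def)
  then have bdd: "bdd_below (F y ` {0..})" for y
    by (intro bdd_belowI[of _ "- p (- y)"]) auto
  have qF: "q y \<le> F y t" if "0 \<le> t" for y t
    unfolding q_def using that by (intro cINF_lower[OF bdd]) auto
  have qI: "m \<le> q y" if "\<And>t. 0 \<le> t \<Longrightarrow> m \<le> F y t" for m y
    unfolding q_def using that by (intro cINF_greatest) auto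
  have "sublinear q"
  proof (rule sublinearI)
    fix y z
    have "q (y + z) \<le> F y t + F z u" if "0 \<le> t" "0 \<le> u" for t u
    proof -
      have "q (y + z) \<le> F (y + z) (t + u)" using that by (intro qF) simp
      also have "\<dots> \<le> F y t + F z u"
        using pD(1)[of "y + t *\<^sub>R x" "z + u *\<^sub>R x"] by (simp add: F_def algebra_simps)
      finally show ?thesis .
    qed
    then have "q (y + z) - F z u \<le> q y" if "0 \<le> u" for u
      using that by (intro qI) (simp add: algebra_simps)
    then have "q (y + z) - q y \<le> q z"
      by (intro qI) (simp add: algebra_simps)
    then show "q (y + z) \<le> q y + q z" by simp
  next
    fix c :: real and y assume c: "0 < c"
    have "q (c *\<^sub>R y) / c \<le> q y"
    proof (rule qI)
      fix t :: real assume t: "0 \<le> t"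
      have "q (c *\<^sub>R y) \<le> F (c *\<^sub>R y) (c * t)" using c t by (intro qF) simp
      also have "\<dots> = c * F y t"
        using pD(2)[of c "y + t *\<^sub>R x"] c by (simp add: F_def algebra_simps)
      finally show "q (c *\<^sub>R y) / c \<le> F y t" using c by (simp add: field_simps)
    qed
    then show "q (c *\<^sub>R y) \<le> c * q y" using c by (simp add: field_simps)
  next
    have "F 0 t = 0" if "0 \<le> t" for t using pD(2)[OF that] by (simp add: F_def)
    then show "q 0 = 0" using qF[of 0 0] qI[of 0 0] by simp
  qed
  moreover have "q \<le> p" using qF[of 0] by (auto simp: le_fun_def F_def)
  moreover have "q (- x) \<le> - p x" using qF[of 1 "- x"] pD(3) by (simp add: F_def)
  ultimately show ?thesis using that by blast
qed

text \<open>Minimality identifies \<open>p\<close> with the decreased functional, so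
  \<open>p (- x) \<le> - p x\<close>. Hence \<open>p\<close> is odd, and an odd sublinear functional
  is linear.\<close>

lemma minimal_sublinear_linear:
  fixes p :: "'a::real_vector \<Rightarrow> real"
  assumes p: "sublinear p" and min: "\<And>q. sublinear q \<Longrightarrow> q \<le> p \<Longrightarrow> q = p"
  shows "linear p"
proof -
  note pD = sublinearD[OF p]
  have neg: "p (- x) = - p x" for x
  proof -
    obtain q where "sublinear q" "q \<le> p" "q (- x) \<le> - p x" using sublinear_decrease[OF p] .
    then have "p (- x) \<le> - p x" using min by blast
    then show ?thesis using pD(4)[of x] by simp
  qed
  show ?thesis
  proof (rule linearI)
    show "p (x + y) = p x + p y" for x y
      using pD(1)[of x y] pD(1)[of "- x" "- y"] neg[of "x + y"] neg[of x] neg[of y] by simp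
    show "p (c *\<^sub>R x) = c *\<^sub>R p x" for c x
      using pD(2)[of c x] pD(2)[of "- c" x] neg[of "c *\<^sub>R x"] by (cases "0 \<le> c") auto
  qed
qed

text \<open>Zorn's lemma: a nonempty chain below \<open>p\<close> has its pointwise infimum as a
  lower bound, finite because every member is at least \<open>- p (- x)\<close> at
  \<open>x\<close>.\<close>

lemma ex_minimal_sublinear:
  fixes p :: "'a::real_vector \<Rightarrow> real"
  assumes p: "sublinear p"
  obtains m where "sublinear m" "m \<le> p" "\<And>q. sublinear q \<Longrightarrow> q \<le> m \<Longrightarrow> q = m"
proof -
  define A where "A = {q. sublinear q \<and> q \<le> p}"
  \<comment> \<open>The order is reversed, so that the maximal element from Zorn's lemma is a
    minimal functional.\<close>
  define R where "R = (\<lambda>q r::'a \<Rightarrow> real. r \<le> q)"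
  have "\<exists>m\<in>A. \<forall>a\<in>A. R m a \<longrightarrow> a = m"
  proof (rule predicate_Zorn)
    show "partial_order_on A (relation_of R A)"
      by (auto simp: partial_order_on_def preorder_on_def refl_on_def trans_def antisym_def
          relation_of_def R_def)
    fix C assume C: "C \<in> Chains (relation_of R A)"
    have CA: "C \<subseteq> A" using C by (auto simp: Chains_def relation_of_def)
    have tot: "q \<le> r \<or> r \<le> q" if "q \<in> C" "r \<in> C" for q r
      using C that by (auto simp: Chains_def relation_of_def R_def)
    show "\<exists>u\<in>A. \<forall>a\<in>C. R a u"
    proof (cases "C = {}")
      case True
      then show ?thesis using p by (auto simp: A_def)
    next
      case False
      define u where "u = (\<lambda>x. INF q\<in>C. q x)"
      have sq: "sublinear q" "q \<le> p" if "q \<in> C" for q using CA that by (auto simp: A_def)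
      have "- p (- x) \<le> q x" if "q \<in> C" for q x
        using sublinearD(4)[OF sq(1)[OF that], of x] sq(2)[OF that] by (auto simp: le_fun_def intro: order_trans[rotated])
      then have bdd: "bdd_below ((\<lambda>q. q x) ` C)" for x
        by (intro bdd_belowI[of _ "- p (- x)"]) auto
      have uq: "u x \<le> q x" if "q \<in> C" for q x
        unfolding u_def using that by (intro cINF_lower[OF bdd]) auto
      have uI: "m \<le> u x" if "\<And>q. q \<in> C \<Longrightarrow> m \<le> q x" for m x
        unfolding u_def using that False by (intro cINF_greatest) auto
      have "sublinear u"
      proof (rule sublinearI)
        fix x y
        \<comment> \<open>The smaller of \<open>q\<close> and \<open>r\<close> is again in the chain
          and is subadditive; this is what makes the infimum subadditive.\<close>
        have *: "u (x + y) \<le> q x + r y" if qr: "q \<in> C" "r \<in> C" for q r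
        proof -
          obtain t where t: "t \<in> C" "t \<le> q" "t \<le> r" using tot[OF qr] qr by blast
          have "u (x + y) \<le> t (x + y)" using uq t by blast
          also have "\<dots> \<le> t x + t y" by (rule sublinearD(1)[OF sq(1)[OF t(1)]])
          also have "\<dots> \<le> q x + r y" using t by (intro add_mono) (auto simp: le_fun_def)
          finally show ?thesis .
        qed
        have "u (x + y) - r y \<le> u x" if "r \<in> C" for r
          using * that by (intro uI) (simp add: algebra_simps)
        then have "u (x + y) - u x \<le> u y" by (intro uI) (simp add: algebra_simps)
        then show "u (x + y) \<le> u x + u y" by simp
      next
        fix c :: real and x assume c: "0 < c"
        have "u (c *\<^sub>R x) / c \<le> u x"
        proof (rule uI)
          fix q assume q: "q \<in> C"
          have "u (c *\<^sub>R x) \<le> c * q x" using uq[OF q, of "c *\<^sub>R x"] sublinearD(2)[OF sq(1)[OF q], of c x] c by simp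
          then show "u (c *\<^sub>R x) / c \<le> q x" using c by (simp add: field_simps)
        qed
        then show "u (c *\<^sub>R x) \<le> c * u x" using c by (simp add: field_simps)
      next
        have "q 0 = 0" if "q \<in> C" for q using sublinearD(3)[OF sq(1)[OF that]] .
        then have "u 0 = (INF q\<in>C. (0::real))" unfolding u_def by (intro INF_cong) auto
        then show "u 0 = 0" using False by simp
      qed
      moreover have "u \<le> q" if "q \<in> C" for q using uq[OF that] by (simp add: le_fun_def)
      moreover have "u \<le> p" using False sq(2) calculation(2) order_trans by blast
      ultimately show ?thesis by (auto simp: A_def R_def)
    qed
  qed
  then obtain m where m: "m \<in> A" "\<And>a. a \<in> A \<Longrightarrow> a \<le> m \<Longrightarrow> a = m" unfolding R_def by blast
  show ?thesis
  proof (rule that[of m])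
    show "sublinear m" "m \<le> p" using m(1) by (auto simp: A_def)
    show "q = m" if "sublinear q" "q \<le> m" for q
      using m that by (auto simp: A_def intro: order_trans)
  qed
qed

text \<open>Decrease the norm in the direction of \<open>x\<close> first and pass to a minimal,
  hence linear, \<open>m\<close> below. Then \<open>m (- x) \<le> - norm x\<close>, which forces
  \<open>m x = norm x\<close>.\<close>

lemma ex_norming_functional:
  fixes x :: "'a::real_normed_vector"
  obtains f :: "'a \<Rightarrow>\<^sub>L real" where "norm f \<le> 1" "blinfun_apply f x = norm x"
proof -
  obtain q where q: "sublinear q" "q \<le> norm" "q (- x) \<le> - norm x"
    using sublinear_decrease[OF sublinear_norm] .
  obtain m where m: "sublinear m" "m \<le> q" "\<And>q. sublinear q \<Longrightarrow> q \<le> m \<Longrightarrow> q = m"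
    by (rule ex_minimal_sublinear[OF q(1)]) blast
  have lin: "linear m" using minimal_sublinear_linear m by blast
  have le: "m y \<le> norm y" for y using m(2) q(2) by (auto simp: le_fun_def intro: order_trans)
  have neg: "m (- y) = - m y" for y using linear_neg[OF lin] by simp
  have abs: "\<bar>m y\<bar> \<le> norm y" for y using le[of y] le[of "- y"] neg[of y] by simp
  have bl: "bounded_linear m"
    using lin abs by (intro bounded_linear.intro bounded_linear_axioms.intro) (auto intro!: exI[of _ 1])
  have "norm x \<le> m x" using m(2) q(3) neg[of x] by (auto simp: le_fun_def intro: order_trans dest: spec[of _ "- x"])
  then have "m x = norm x" using le[of x] by simp
  moreover have "norm (Blinfun m) \<le> 1"
    using abs by (intro norm_blinfun_bound) (auto simp: bounded_linear_Blinfun_apply[OF bl])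
  ultimately show ?thesis using that[of "Blinfun m"] by (simp add: bounded_linear_Blinfun_apply[OF bl])
qed

text \<open>The functionals with value at most \<open>c\<close> at \<open>x\<close> form a weak*
  closed set, so a bound on the countable dense set \<open>C\<close> passes to the whole dual ball,
  including a norming functional. Norm bounds thus become countably many scalar
  inequalities.\<close>

lemma weak_star_separable_norming:
  assumes "weak_star_separable_dual_ball TYPE('a::real_normed_vector)"
  obtains C :: "('a::real_normed_vector \<Rightarrow>\<^sub>L real) set" where "countable C"
    "\<And>x c. norm x \<le> c \<longleftrightarrow> (\<forall>f\<in>C. blinfun_apply f x \<le> c)"
proof -
  let ?B = "cball (0 :: 'a \<Rightarrow>\<^sub>L real) 1" and ?W = "strong_operator_topology :: ('a \<Rightarrow>\<^sub>L real) topology"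
  obtain C where C: "countable C" "C \<subseteq> ?B" "subtopology ?W ?B closure_of C = ?B"
    using assms unfolding weak_star_separable_dual_ball_def separable_space_def
    by (auto simp: strong_operator_topology_topspace)
  have 1: "norm x \<le> c" if *: "\<forall>f\<in>C. blinfun_apply f x \<le> c" for x c
  proof -
    obtain f where f: "norm f \<le> 1" "blinfun_apply f x = norm x" using ex_norming_functional .
    have cl: "closedin ?W {f. blinfun_apply f x \<le> c}"
      using closedin_continuous_map_preimage[OF strong_operator_topology_continuous_evaluation[of x], of "{..c}"]
      by (simp add: strong_operator_topology_topspace)
    have "?W closure_of C \<subseteq> {f. blinfun_apply f x \<le> c}"
      using * by (intro closure_of_minimal cl) auto
    moreover have "f \<in> ?W closure_of C"
      using f(1) C(2,3) closure_of_subtopology_subset[of ?W ?B C] by auto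
    ultimately show ?thesis using f by auto
  qed
  have 2: "blinfun_apply f x \<le> c" if "norm x \<le> c" "f \<in> C" for f x c
  proof -
    have "\<bar>blinfun_apply f x\<bar> \<le> norm f * norm x" using norm_blinfun[of f x] by simp
    also have "\<dots> \<le> 1 * norm x" using C(2) that by (intro mult_right_mono) auto
    finally show ?thesis using that by simp
  qed
  have "norm x \<le> c \<longleftrightarrow> (\<forall>f\<in>C. blinfun_apply f x \<le> c)" for x c
    using 1[of x c] 2[of x c] by auto
  with C(1) show ?thesis by (rule that)
qed

section \<open>McShane and Henstock sums\<close>

text \<open>Passes from lists to finite sets of tagged intervals, the format of
  \<open>tagged_division_of\<close>, while still allowing tags outside their intervals. Enumerating
  the set without repetition turns distinct pairs into distinct indices.\<close>

lemma mcshane_bound_finite_set: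
  fixes \<phi> :: "real \<Rightarrow> 'a::real_normed_vector"
  assumes bound: "\<And>p. mcshane_partition p \<Longrightarrow> subordinate p \<delta> \<Longrightarrow> norm (w - mcshane_sum \<phi> p) \<le> \<epsilon>"
    and fin: "finite P"
    and tag: "\<And>x K. (x, K) \<in> P \<Longrightarrow> x \<in> {0..1}"
    and ivl: "\<And>x K. (x, K) \<in> P \<Longrightarrow> K \<noteq> {} \<and> (\<exists>a b. K = {a..b})"
    and sub: "\<And>x K. (x, K) \<in> P \<Longrightarrow> K \<subseteq> {x - \<delta> x..x + \<delta> x}"
    and disj: "\<And>x K y L. (x, K) \<in> P \<Longrightarrow> (y, L) \<in> P \<Longrightarrow> (x, K) \<noteq> (y, L) \<Longrightarrow> interior K \<inter> interior L = {}"
    and cover: "(\<Union>(x, K)\<in>P. K) = {0..1}"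
  shows "norm (w - (\<Sum>(x, K)\<in>P. measure lborel K *\<^sub>R \<phi> x)) \<le> \<epsilon>"
proof -
  obtain xs where xs: "set xs = P" "distinct xs" using finite_distinct_list[OF fin] by blast
  define F where "F = (\<lambda>(x::real, K::real set). ((Inf K, Sup K), x))"
  have K: "Inf K \<le> Sup K" "{Inf K..Sup K} = K" if "(x, K) \<in> P" for x K
    using ivl[OF that] by auto
  have part: "mcshane_partition (map F xs)"
    unfolding mcshane_partition_def
  proof (intro conjI allI impI)
    show "\<forall>((a, b), t)\<in>set (map F xs). a \<le> b \<and> t \<in> {0..1}"
      using K(1) tag xs(1) by (auto simp: F_def)
    fix i j assume "i < length (map F xs)" "j < length (map F xs)" "i \<noteq> j"
    then have ij: "i < length xs" "j < length xs" "xs ! i \<noteq> xs ! j"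
      using xs(2) by (auto simp: nth_eq_iff_index_eq)
    obtain x A y B where xA: "xs ! i = (x, A)" and yB: "xs ! j = (y, B)" by fastforce
    have "(x, A) \<in> P" "(y, B) \<in> P" using ij nth_mem xs(1) xA yB by metis+
    then show "interior {fst (fst (map F xs ! i))..snd (fst (map F xs ! i))} \<inter>
        interior {fst (fst (map F xs ! j))..snd (fst (map F xs ! j))} = {}"
      using disj[of x A y B] ij xA yB K(2)[of x A] K(2)[of y B] by (simp add: F_def)
  next
    have "(\<Union>((a, b), t)\<in>set (map F xs). {a..b}) = (\<Union>(x, K)\<in>P. {Inf K..Sup K})"
      using xs(1) unfolding F_def by auto
    also have "\<dots> = (\<Union>(x, K)\<in>P. K)" using K(2) by (intro SUP_cong) auto
    finally show "(\<Union>((a, b), t)\<in>set (map F xs). {a..b}) = {0..1}" using cover by simp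
  qed
  have "subordinate (map F xs) \<delta>"
    unfolding subordinate_def
  proof (clarsimp simp: xs(1) F_def)
    fix x L assume P: "(x, L) \<in> P"
    have *: "{Inf L..Sup L} \<subseteq> {x - \<delta> x..x + \<delta> x}" using sub[OF P] unfolding K(2)[OF P] .
    then show "x - \<delta> x \<le> Inf L \<and> Inf L \<le> Sup L \<and> Sup L \<le> x + \<delta> x"
      using iffD1[OF atLeastatMost_subset_iff *] K(1)[OF P] by auto
  qed
  moreover have "mcshane_sum \<phi> (map F xs) = (\<Sum>(x, K)\<in>P. measure lborel K *\<^sub>R \<phi> x)"
  proof -
    have c: "measure lborel L = Sup L - Inf L" if "(x, L) \<in> P" for x L
      using content_real[OF K(1)[OF that]] unfolding K(2)[OF that] .
    have "mcshane_sum \<phi> (map F xs) = (\<Sum>(x, K)\<leftarrow>xs. (Sup K - Inf K) *\<^sub>R \<phi> x)"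
      unfolding mcshane_sum_def F_def by (simp add: comp_def case_prod_unfold)
    also have "\<dots> = (\<Sum>(x, K)\<in>P. (Sup K - Inf K) *\<^sub>R \<phi> x)"
      using xs by (simp add: sum_list_distinct_conv_sum_set)
    also have "\<dots> = (\<Sum>(x, K)\<in>P. measure lborel K *\<^sub>R \<phi> x)"
      using c by (intro sum.cong) auto
    finally show ?thesis .
  qed
  ultimately show ?thesis using bound[OF part] by simp
qed

text \<open>A tagged division is a McShane partition whose tags lie in their own intervals, so the
  Henstock-Kurzweil sums of \<open>f \<circ> \<phi>\<close> converge. The later use is that
  \<open>f \<circ> \<phi>\<close> is Lebesgue measurable.\<close>

lemma mcshane_imp_has_integral:
  fixes \<phi> :: "real \<Rightarrow> 'a::real_normed_vector" and f :: "'a \<Rightarrow>\<^sub>L real"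
  assumes "has_mcshane_integral \<phi> w"
  shows "((\<lambda>t. blinfun_apply f (\<phi> t)) has_integral blinfun_apply f w) {0..1}"
  unfolding has_integral_real
proof (intro allI impI)
  fix e :: real assume e: "0 < e"
  \<comment> \<open>The added 1 covers \<open>f = 0\<close>; the half yields the strict
    inequality.\<close>
  define e' where "e' = e / 2 / (norm f + 1)"
  have nf: "0 < norm f + 1" by (simp add: add_nonneg_pos)
  have e'0: "0 < e'" using e nf unfolding e'_def by (intro divide_pos_pos) auto
  have "norm f * e' \<le> (norm f + 1) * e'" using e'0 by (intro mult_right_mono) auto
  also have "\<dots> = e / 2"
    using nf unfolding e'_def by (metis nonzero_mult_div_cancel_left times_divide_eq_right less_irrefl)
  finally have e': "0 < e'" "norm f * e' < e" using e e'0 by auto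
  obtain \<delta> where \<delta>: "mcshane_gauge \<delta>"
    and bound: "\<And>p. mcshane_partition p \<Longrightarrow> subordinate p \<delta> \<Longrightarrow> norm (w - mcshane_sum \<phi> p) \<le> e'"
    using assms e'(1) unfolding has_mcshane_integral_def by blast
  \<comment> \<open>\<open>gauge\<close> asks for a neighbourhood of every real, whereas
    \<open>\<delta>\<close> is known to be positive only on [0,1]; the radius 1 is a filler
    elsewhere.\<close>
  define \<gamma> where "\<gamma> = (\<lambda>x. ball x (if x \<in> {0..1} then \<delta> x else 1))"
  have "gauge \<gamma>" using \<delta> unfolding \<gamma>_def mcshane_gauge_def by (intro gauge_ball_dependent) auto
  show "\<exists>\<gamma>. gauge \<gamma> \<and> (\<forall>D. D tagged_division_of {0..1} \<and> \<gamma> fine D \<longrightarrow>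
      norm ((\<Sum>(x, K)\<in>D. measure lborel K *\<^sub>R blinfun_apply f (\<phi> x)) - blinfun_apply f w) < e)"
  proof (intro exI[of _ \<gamma>] conjI allI impI \<open>gauge \<gamma>\<close>, elim conjE)
    fix D assume D: "D tagged_division_of {0..1}" and fine: "\<gamma> fine D"
    note Dd = tagged_division_ofD[OF D]
    have "norm (w - (\<Sum>(x, K)\<in>D. measure lborel K *\<^sub>R \<phi> x)) \<le> e'"
    proof (rule mcshane_bound_finite_set[OF bound Dd(1)])
      fix x K assume xK: "(x, K) \<in> D"
      show x01: "x \<in> {0..1}" using Dd(2,3)[OF xK] by blast
      show "K \<noteq> {} \<and> (\<exists>a b. K = {a..b})" using Dd(2,4)[OF xK] by auto
      have "K \<subseteq> ball x (\<delta> x)" using fineD[OF fine xK] x01 by (simp add: \<gamma>_def)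
      then show "K \<subseteq> {x - \<delta> x..x + \<delta> x}" by (auto simp: ball_eq_greaterThanLessThan)
    next
      show "(\<Union>(x, K)\<in>D. K) = {0..1}" using Dd(6) by auto
    qed (use Dd(5) in auto)
    then have "norm f * norm (w - (\<Sum>(x, K)\<in>D. measure lborel K *\<^sub>R \<phi> x)) \<le> norm f * e'"
      by (intro mult_left_mono) auto
    moreover have "norm (blinfun_apply f (w - (\<Sum>(x, K)\<in>D. measure lborel K *\<^sub>R \<phi> x)))
        \<le> norm f * norm (w - (\<Sum>(x, K)\<in>D. measure lborel K *\<^sub>R \<phi> x))" by (rule norm_blinfun)
    moreover have "blinfun_apply f (\<Sum>(x, K)\<in>D. measure lborel K *\<^sub>R \<phi> x) = (\<Sum>(x, K)\<in>D. measure lborel K *\<^sub>R blinfun_apply f (\<phi> x))"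
      by (simp add: blinfun.sum_right blinfun.scaleR_right case_prod_unfold)
    ultimately show "norm ((\<Sum>(x, K)\<in>D. measure lborel K *\<^sub>R blinfun_apply f (\<phi> x)) - blinfun_apply f w) < e"
      using e'(2) by (simp add: blinfun.diff_right norm_minus_commute)
  qed
qed

text \<open>Extend \<open>p\<close> to a division of [0,1] and apply Cousin's lemma in each
  interval. The pieces outside \<open>p\<close> form \<open>Q\<close>; all pieces form
  \<open>R\<close>. Thus \<open>Q\<close> is part of a fine division of all of [0,1], and sums of
  nonnegative functions over \<open>Q\<close> are bounded by sums over \<open>R\<close>.\<close>

lemma fine_complement_of_division:
  fixes p :: "real set set"
  assumes ga: "gauge \<gamma>" and p: "p division_of \<Union>p" and sub: "\<Union>p \<subseteq> {0..1}"
    and int: "\<And>K. K \<in> p \<Longrightarrow> interior K \<noteq> {}"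
  obtains Q R where "Q tagged_division_of \<Union>(snd ` Q)" "\<gamma> fine Q"
    "\<And>x K L. (x, K) \<in> Q \<Longrightarrow> L \<in> p \<Longrightarrow> interior K \<inter> interior L = {}"
    "\<Union>p \<union> \<Union>(snd ` Q) = {0..1}"
    "(\<Sum>(x, K)\<in>Q. measure lborel K) = 1 - (\<Sum>K\<in>p. measure lborel K)"
    "Q \<subseteq> R" "R tagged_division_of {0..1}" "\<gamma> fine R"
proof -
  obtain q where q: "p \<subseteq> q" "q division_of {0..1}"
    using partial_division_extend_interval[OF p, of 0 1] sub by auto
  note qd = division_ofD[OF q(2)]
  have "\<forall>K\<in>q. \<exists>d. d tagged_division_of K \<and> \<gamma> fine d"
    using qd(4) fine_division_exists[OF ga] by metis
  then obtain d where d: "\<And>K. K \<in> q \<Longrightarrow> d K tagged_division_of K" "\<And>K. K \<in> q \<Longrightarrow> \<gamma> fine d K"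
    by metis
  define R where "R = \<Union>(d ` q)"
  define Q where "Q = \<Union>(d ` (q - p))"
  have R: "R tagged_division_of {0..1}"
    using tagged_division_Union[OF qd(1) d(1) qd(5)] qd(6) by (simp add: R_def)
  have Q0: "Q tagged_division_of \<Union>(q - p)"
    unfolding Q_def using d(1) qd by (intro tagged_division_Union) auto
  have "snd ` Q = {K. \<exists>x. (x, K) \<in> Q}" by force
  then have UQ: "\<Union>(snd ` Q) = \<Union>(q - p)"
    using tagged_division_ofD(6)[OF Q0] by simp
  have disj: "interior K \<inter> interior L = {}" if xK: "(x, K) \<in> Q" and L: "L \<in> p" for x K L
  proof -
    obtain K' where K': "K' \<in> q" "K' \<notin> p" "(x, K) \<in> d K'" using xK by (auto simp: Q_def)
    have "interior K \<subseteq> interior K'" using tagged_division_ofD(3)[OF d(1)[OF K'(1)] K'(3)] by (rule interior_mono)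
    moreover have "interior K' \<inter> interior L = {}" using qd(5)[OF K'(1), of L] q(1) L K'(2) by blast
    ultimately show ?thesis by blast
  qed
  define pt where "pt = (\<lambda>K. (SOME x::real. x \<in> K, K))"
  have ptin: "fst (pt K) \<in> K" if "K \<in> q" for K
    unfolding pt_def using qd(3)[OF that] by (simp add: some_in_eq)
  define d' where "d' = (\<lambda>K. if K \<in> p then {pt K} else d K)"
  have d': "d' K tagged_division_of K" if Kq: "K \<in> q" for K
  proof (cases "K \<in> p")
    case True
    obtain a b where "K = cbox a b" using qd(4)[OF Kq] by blast
    then show ?thesis using True ptin[OF Kq] tagged_division_of_self[of "fst (pt K)" a b]
      by (simp add: d'_def pt_def)
  qed (use d(1)[OF Kq] in \<open>simp add: d'_def\<close>)
  have un: "\<Union>(d' ` q) = Q \<union> pt ` p" using q(1) by (auto simp: d'_def Q_def split: if_splits)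
  have T: "(Q \<union> pt ` p) tagged_division_of cbox 0 1"
    using tagged_division_Union[OF qd(1) d' qd(5)] qd(6) un by simp
  have "1 = (\<Sum>(x, K)\<in>Q \<union> pt ` p. measure lborel K)"
    using additive_content_tagged_division[OF T] by simp
  also have "\<dots> = (\<Sum>(x, K)\<in>Q. measure lborel K) + (\<Sum>(x, K)\<in>pt ` p. measure lborel K)"
  proof (rule sum.union_disjoint)
    show "finite Q" using Q0 by blast
    show "finite (pt ` p)" using p by blast
    show "Q \<inter> pt ` p = {}" using disj int unfolding pt_def by fastforce
  qed
  also have "(\<Sum>(x, K)\<in>pt ` p. measure lborel K) = (\<Sum>K\<in>p. measure lborel K)"
    by (subst sum.reindex) (auto simp: pt_def inj_on_def)
  finally have c: "(\<Sum>(x, K)\<in>Q. measure lborel K) = 1 - (\<Sum>K\<in>p. measure lborel K)" by simp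
  show ?thesis
  proof (rule that[of Q R])
    show "Q tagged_division_of \<Union>(snd ` Q)" using Q0 UQ by simp
    show "\<gamma> fine Q" "\<gamma> fine R" using d(2) by (auto simp: Q_def R_def intro!: fine_Union)
    show "Q \<subseteq> R" by (auto simp: Q_def R_def)
    have "p \<union> (q - p) = q" using q(1) by blast
    then show "\<Union>p \<union> \<Union>(snd ` Q) = {0..1}" unfolding UQ qd(6)[symmetric] by (metis Union_Un_distrib)
    show "interior K \<inter> interior L = {}" if "(x, K) \<in> Q" "L \<in> p" for x K L by (rule disj[OF that])
  qed (rule R c)+
qed

section \<open>Samples as tags of McShane partitions\<close>

lemma interior_Int_empty_Icc:
  fixes a b c d :: real
  assumes "b \<le> c"
  shows "interior {a..b} \<inter> interior {c..d} = {}"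
  using assms by auto

text \<open>Every selected sample \<open>s i\<close> is allotted an interval of length \<open>\<rho> / n\<close> inside its bin
  \<open>{j/k..(j+1)/k}\<close>; these are packed side by side from the left end of the bin.\<close>
lemma mcshane_sample_estimate:
  fixes \<phi> :: "real \<Rightarrow> 'a::real_normed_vector" and n k :: nat
  assumes bound: "\<And>p. mcshane_partition p \<Longrightarrow> subordinate p \<delta> \<Longrightarrow> norm (w - mcshane_sum \<phi> p) \<le> \<epsilon>"
    and ga: "gauge \<gamma>" and ga_sub: "\<And>x. x \<in> {0..1} \<Longrightarrow> \<gamma> x \<subseteq> ball x (\<delta> x)"
    and maj: "\<And>x. x \<in> {0..1} \<Longrightarrow> norm (\<phi> x) \<le> N + g x" and g0: "\<And>x. x \<in> {0..1} \<Longrightarrow> 0 \<le> g x"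
    and HK: "\<And>R. R tagged_division_of {0..1} \<Longrightarrow> \<gamma> fine R \<Longrightarrow> (\<Sum>(x, K)\<in>R. measure lborel K * g x) \<le> \<eta>"
    and n: "0 < n" and k: "0 < k" and lam: "0 < \<rho>"
    and s: "\<And>i. i < n \<Longrightarrow> s i \<in> {0..1}"
    and G: "G \<subseteq> {..<n}" "\<And>i. i \<in> G \<Longrightarrow> 1 / real k \<le> \<delta> (s i)"
    and bins: "\<And>j. j < k \<Longrightarrow> real (card {i. i < n \<and> s i \<in> {real j / real k..real (Suc j) / real k}}) * (\<rho> / real n) \<le> 1 / real k"
  shows "norm (w - (\<rho> / real n) *\<^sub>R (\<Sum>i\<in>G. \<phi> (s i))) \<le> \<epsilon> + N * (1 - \<rho> * real (card G) / real n) + \<eta>"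
proof -
  define l where "l = \<rho> / real n"
  have l: "0 < l" using lam n by (simp add: l_def)
  have finG: "finite G" using G(1) finite_subset by blast
  define B where "B = (\<lambda>j. {real j / real k..real (Suc j) / real k})"
  have "\<exists>j<k. s i \<in> B j" if "i \<in> G" for i
  proof (cases "s i = 1")
    \<comment> \<open>The right endpoint goes into the last bin; the floor taken in the other case
      would give \<open>j = k\<close>.\<close>
    case True
    then show ?thesis using k by (intro exI[of _ "k - 1"]) (auto simp: B_def field_simps of_nat_diff)
  next
    case False
    have si: "0 \<le> s i" "s i < 1" using s[of i] that G(1) False by auto
    define j where "j = nat \<lfloor>real k * s i\<rfloor>"
    have "real j \<le> real k * s i" "real k * s i < real (Suc j)"
      using si by (auto simp: j_def) linarith+
    note j = this
    have "real k * s i < real k" using si k by simp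
    then have "j < k" using j(1) by (metis of_nat_less_iff order_le_less_trans)
    moreover have "s i \<in> B j" using j k by (auto simp: B_def field_simps)
    ultimately show ?thesis by blast
  qed
  then obtain b where b: "\<And>i. i \<in> G \<Longrightarrow> b i < k" "\<And>i. i \<in> G \<Longrightarrow> s i \<in> B (b i)" by metis
  \<comment> \<open>The rank of \<open>i\<close> among the selected samples assigned to the same bin
    fixes its slot.\<close>
  define r where "r = (\<lambda>i. card {j \<in> G. j < i \<and> b j = b i})"
  define a where "a = (\<lambda>i. real (b i) / real k + real (r i) * l)"
  define K where "K = (\<lambda>i. {a i..a i + l})"
  have a_upper: "a i + l \<le> real (Suc (b i)) / real k" if i: "i \<in> G" for i
  proof -
    \<comment> \<open>The slots used up to and including \<open>i\<close> are at most as many as the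
      samples in the bin, and \<open>bins\<close> says that so many slots fit.\<close>
    have "Suc (r i) = card (insert i {j \<in> G. j < i \<and> b j = b i})"
      unfolding r_def using finG by (subst card_insert_disjoint) auto
    also have "\<dots> \<le> card {j. j < n \<and> s j \<in> B (b i)}"
    proof (rule card_mono)
      have "s j \<in> B (b i)" if "j \<in> G" "b j = b i" for j using b(2)[OF that(1)] that(2) by simp
      then show "insert i {j \<in> G. j < i \<and> b j = b i} \<subseteq> {j. j < n \<and> s j \<in> B (b i)}"
        using i G(1) by auto
    qed simp
    finally have "real (Suc (r i)) * l \<le> real (card {j. j < n \<and> s j \<in> B (b i)}) * l"
      using l by (intro mult_right_mono) auto
    also have "\<dots> \<le> 1 / real k" using bins[OF b(1)[OF i]] unfolding B_def l_def .
    finally show ?thesis by (simp add: a_def algebra_simps add_divide_distrib)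
  qed
  have a_lower: "real (b i) / real k \<le> a i" for i using l by (simp add: a_def)
  have sep: "a i + l \<le> a j" if i: "i \<in> G" and j: "j \<in> G" and ij: "b i < b j \<or> b i = b j \<and> i < j" for i j
    using ij
  proof
    assume "b i < b j"
    then have "real (Suc (b i)) / real k \<le> real (b j) / real k" by (intro divide_right_mono) auto
    then show ?thesis using a_upper[OF i] a_lower[of j] by linarith
  next
    assume bij: "b i = b j \<and> i < j"
    have "Suc (r i) = card (insert i {m \<in> G. m < i \<and> b m = b i})"
      unfolding r_def using finG by (subst card_insert_disjoint) auto
    also have "\<dots> \<le> r j"
      unfolding r_def using i bij finG by (intro card_mono) auto
    finally have "real (Suc (r i)) * l \<le> real (r j) * l"
      using l by (intro mult_right_mono) auto
    then show ?thesis using bij by (simp add: a_def algebra_simps)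
  qed
  have sep': "a i + l \<le> a j \<or> a j + l \<le> a i" if "i \<in> G" "j \<in> G" "i \<noteq> j" for i j
    using sep[of i j] sep[of j i] that by (metis linorder_neqE_nat)
  have Kdisj: "interior (K i) \<inter> interior (K j) = {}" if "i \<in> G" "j \<in> G" "i \<noteq> j" for i j
    using sep'[OF that] interior_Int_empty_Icc[of "a i + l" "a j" "a i" "a j + l"]
      interior_Int_empty_Icc[of "a j + l" "a i" "a j" "a i + l"] unfolding K_def by blast
  have Kint: "interior (K i) \<noteq> {}" for i using l by (simp add: K_def)
  have Kinj: "inj_on K G" using Kdisj Kint by (metis inf.idem inj_onI)
  have KB: "K i \<subseteq> B (b i)" if "i \<in> G" for i
    using a_lower[of i] a_upper[OF that] by (auto simp: K_def B_def)
  have B01: "B j \<subseteq> {0..1}" if "j < k" for j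
  proof -
    have "real (Suc j) \<le> real k" using that by simp
    then have "real (Suc j) / real k \<le> 1" using k by (subst divide_le_eq_1) auto
    moreover have "0 \<le> real j / real k" by simp
    ultimately show ?thesis by (auto simp: B_def)
  qed
  have Kc: "measure lborel (K i) = l" for i using l by (simp add: K_def)
  have pdiv: "(K ` G) division_of \<Union>(K ` G)"
  proof (rule division_ofI)
    show "interior L \<inter> interior M = {}" if "L \<in> K ` G" "M \<in> K ` G" "L \<noteq> M" for L M
      using that Kdisj by blast
    show "\<exists>a b. L = cbox a b" if "L \<in> K ` G" for L using that by (auto simp: K_def)
    show "L \<noteq> {}" if "L \<in> K ` G" for L using that l by (auto simp: K_def)
  qed (use finG in auto)
  have psub: "\<Union>(K ` G) \<subseteq> {0..1}" using KB B01 b(1) by blast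
  obtain Q R where Q: "Q tagged_division_of \<Union>(snd ` Q)" "\<gamma> fine Q"
    "\<And>x K' L. (x, K') \<in> Q \<Longrightarrow> L \<in> K ` G \<Longrightarrow> interior K' \<inter> interior L = {}"
    "\<Union>(K ` G) \<union> \<Union>(snd ` Q) = {0..1}"
    "(\<Sum>(x, K')\<in>Q. measure lborel K') = 1 - (\<Sum>K'\<in>K ` G. measure lborel K')"
    "Q \<subseteq> R" and R: "R tagged_division_of {0..1}" "\<gamma> fine R"
  proof (rule fine_complement_of_division[OF ga pdiv psub])
    show "interior L \<noteq> {}" if "L \<in> K ` G" for L using that Kint by blast
  qed blast
  have Qc: "(\<Sum>(x, K')\<in>Q. measure lborel K') = 1 - \<rho> * real (card G) / real n"
    using Q(5) by (simp add: sum.reindex[OF Kinj] Kc l_def)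
  note Qd = tagged_division_ofD[OF Q(1)]
  note Rd = tagged_division_ofD[OF R(1)]
  have Q01: "x \<in> {0..1}" if "(x, L) \<in> Q" for x L using Rd(2,3)[of x L] Q(6) that by blast
  define P where "P = (\<lambda>i. (s i, K i)) ` G"
  have inter: "P \<inter> Q = {}" using Q(3) Kint unfolding P_def by fastforce
  have "norm (w - (\<Sum>(x, L)\<in>P \<union> Q. measure lborel L *\<^sub>R \<phi> x)) \<le> \<epsilon>"
  proof (rule mcshane_bound_finite_set[OF bound])
    show "finite (P \<union> Q)" using finG Qd(1) by (simp add: P_def)
    show "x \<in> {0..1}" if "(x, L) \<in> P \<union> Q" for x L
      using that
    proof
      assume "(x, L) \<in> P"
      then obtain i where "i \<in> G" "x = s i" by (auto simp: P_def)
      then show ?thesis using s[of i] G(1) by auto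
    qed (use Q01 in blast)
    show "L \<noteq> {} \<and> (\<exists>a b. L = {a..b})" if "(x, L) \<in> P \<union> Q" for x L
      using that
    proof
      assume "(x, L) \<in> P"
      then show ?thesis using l by (auto simp: P_def K_def)
    next
      assume "(x, L) \<in> Q"
      then show ?thesis using Qd(2,4)[of x L] by auto
    qed
    show "L \<subseteq> {x - \<delta> x..x + \<delta> x}" if "(x, L) \<in> P \<union> Q" for x L
      using that
    proof
      assume "(x, L) \<in> P"
      then obtain i where i: "i \<in> G" "x = s i" "L = K i" by (auto simp: P_def)
      \<comment> \<open>Tag and interval share a bin of length
        \<open>1/k \<le> \<delta> (s i)\<close>. The tag may lie outside its interval, which is
        where the McShane rather than the Henstock integral enters.\<close>
      have "real (Suc (b i)) / real k = real (b i) / real k + 1 / real k" by (simp add: add_divide_distrib)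
      then show ?thesis using KB[OF i(1)] b(2)[OF i(1)] G(2)[OF i(1)] i(2,3) unfolding B_def by fastforce
    next
      assume xL: "(x, L) \<in> Q"
      have "L \<subseteq> ball x (\<delta> x)" using fineD[OF Q(2) xL] ga_sub[OF Q01[OF xL]] by blast
      then show ?thesis by (auto simp: ball_eq_greaterThanLessThan)
    qed
    show "interior L \<inter> interior M = {}"
      if "(x, L) \<in> P \<union> Q" "(y, M) \<in> P \<union> Q" "(x, L) \<noteq> (y, M)" for x L y M
    proof -
      have PP: "interior L \<inter> interior M = {}" if "(x, L) \<in> P" "(y, M) \<in> P" "(x, L) \<noteq> (y, M)"
        using that Kdisj by (auto simp: P_def)
      have PQ: "interior L \<inter> interior M = {}" if "(x, L) \<in> Q" "(y, M) \<in> P" for x L y M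
        using Q(3)[OF that(1), of M] that(2) by (auto simp: P_def)
      show ?thesis using PP PQ[of x L y M] PQ[of y M x L] Qd(5)[of x L y M] that by blast
    qed
    have "(\<Union>(x, L)\<in>P. L) = \<Union>(K ` G)" by (auto simp: P_def)
    moreover have "(\<Union>(x, L)\<in>Q. L) = \<Union>(snd ` Q)" by (auto simp: case_prod_unfold)
    ultimately show "(\<Union>(x, L)\<in>P \<union> Q. L) = {0..1}" using Q(4) by simp
  qed
  moreover have "(\<Sum>(x, L)\<in>P \<union> Q. measure lborel L *\<^sub>R \<phi> x)
      = l *\<^sub>R (\<Sum>i\<in>G. \<phi> (s i)) + (\<Sum>(x, L)\<in>Q. measure lborel L *\<^sub>R \<phi> x)"
  proof -
    have "(\<Sum>(x, L)\<in>P. measure lborel L *\<^sub>R \<phi> x) = (\<Sum>i\<in>G. l *\<^sub>R \<phi> (s i))"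
      unfolding P_def using Kinj by (subst sum.reindex) (auto simp: inj_on_def Kc)
    then show ?thesis
      using inter finG Qd(1) by (subst sum.union_disjoint) (auto simp: P_def scaleR_sum_right)
  qed
  \<comment> \<open>The constant \<open>N\<close> is charged to the total length of
    \<open>Q\<close>. The part \<open>g\<close> is nonnegative, so its sum grows when
    \<open>Q\<close> is enlarged to \<open>R\<close>, where \<open>HK\<close> applies.\<close>
  moreover have "norm (\<Sum>(x, L)\<in>Q. measure lborel L *\<^sub>R \<phi> x) \<le> N * (1 - \<rho> * real (card G) / real n) + \<eta>"
  proof -
    have "norm (\<Sum>(x, L)\<in>Q. measure lborel L *\<^sub>R \<phi> x) \<le> (\<Sum>(x, L)\<in>Q. N * measure lborel L + measure lborel L * g x)"
    proof (rule sum_norm_le, clarify)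
      fix x L assume "(x, L) \<in> Q"
      then have "measure lborel L * norm (\<phi> x) \<le> measure lborel L * (N + g x)"
        using maj Q01 by (intro mult_left_mono) auto
      then show "norm (measure lborel L *\<^sub>R \<phi> x) \<le> N * measure lborel L + measure lborel L * g x"
        by (simp add: algebra_simps)
    qed
    also have "\<dots> = N * (\<Sum>(x, L)\<in>Q. measure lborel L) + (\<Sum>(x, L)\<in>Q. measure lborel L * g x)"
      by (simp add: sum.distrib sum_distrib_left case_prod_unfold)
    also have "(\<Sum>(x, L)\<in>Q. measure lborel L * g x) \<le> (\<Sum>(x, L)\<in>R. measure lborel L * g x)"
    proof (rule sum_mono2[OF Rd(1) Q(6)], clarify)
      fix x L assume "(x, L) \<in> R"
      then have "0 \<le> g x" using Rd(2,3)[of x L] g0[of x] by blast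
      then show "0 \<le> measure lborel L * g x" by simp
    qed
    also have "\<dots> \<le> \<eta>" using HK R by blast
    finally show ?thesis using Qc by simp
  qed
  ultimately have "norm (w - (l *\<^sub>R (\<Sum>i\<in>G. \<phi> (s i)) + (\<Sum>(x, L)\<in>Q. measure lborel L *\<^sub>R \<phi> x))) \<le> \<epsilon>"
    "norm (\<Sum>(x, L)\<in>Q. measure lborel L *\<^sub>R \<phi> x) \<le> N * (1 - \<rho> * real (card G) / real n) + \<eta>" by simp_all
  moreover have "norm (w - l *\<^sub>R (\<Sum>i\<in>G. \<phi> (s i)))
      \<le> norm (w - (l *\<^sub>R (\<Sum>i\<in>G. \<phi> (s i)) + (\<Sum>(x, L)\<in>Q. measure lborel L *\<^sub>R \<phi> x)))
        + norm (\<Sum>(x, L)\<in>Q. measure lborel L *\<^sub>R \<phi> x)"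
    by (rule order_trans[OF _ norm_triangle_ineq]) (simp add: algebra_simps)
  ultimately show ?thesis unfolding l_def by linarith
qed

text \<open>Apply the packing estimate to the samples in \<open>E\<close>, then restore what it
  omits. The errors are \<open>6 * \<epsilon>\<close> for the packing, \<open>4 * \<epsilon>\<close>
  for the samples outside \<open>E\<close>, and \<open>3 * \<epsilon>\<close> for the missing weight
  \<open>1 - \<rho>\<close> on those inside.\<close>

lemma mcshane_sample_mean_estimate:
  fixes \<phi> :: "real \<Rightarrow> 'a::real_normed_vector" and n k :: nat
  assumes bound: "\<And>p. mcshane_partition p \<Longrightarrow> subordinate p \<delta> \<Longrightarrow> norm (w - mcshane_sum \<phi> p) \<le> \<epsilon>"
    and ga: "gauge \<gamma>" and ga_sub: "\<And>x. x \<in> {0..1} \<Longrightarrow> \<gamma> x \<subseteq> ball x (\<delta> x)"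
    and maj: "\<And>x. x \<in> {0..1} \<Longrightarrow> norm (\<phi> x) \<le> N + g x" and g0: "\<And>x. x \<in> {0..1} \<Longrightarrow> 0 \<le> g x"
    and HK: "\<And>R. R tagged_division_of {0..1} \<Longrightarrow> \<gamma> fine R \<Longrightarrow> (\<Sum>(x, K)\<in>R. measure lborel K * g x) \<le> 2 * \<epsilon>"
    and n: "0 < n" and k: "0 < k" and eN: "0 < \<epsilon>" "\<epsilon> < 1" "1 \<le> N"
    and s: "\<And>i. s i \<in> {0..1}"
    and good: "\<And>i. s i \<in> E \<Longrightarrow> 1 / real k \<le> \<delta> (s i)"
    and few: "real (card {i. i < n \<and> s i \<notin> E}) / real n \<le> 2 * \<epsilon> / N"
    and bins: "\<And>j. j < k \<Longrightarrow> real (card {i. i < n \<and> s i \<in> {real j / real k..real (Suc j) / real k}}) / real n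
        \<le> 1 / (real k * (1 - \<epsilon> / N))"
    and avg: "(\<Sum>i<n. g (s i)) / real n \<le> 2 * \<epsilon>"
  shows "norm (w - (1 / real n) *\<^sub>R (\<Sum>i<n. \<phi> (s i))) \<le> 13 * \<epsilon>"
proof -
  \<comment> \<open>Shortening the slots by \<open>\<rho>\<close> lets a bin hold up to
    \<open>1 / \<rho>\<close> times its expected share of samples; the choice makes the cost
    \<open>N * (1 - \<rho>)\<close> equal to \<open>\<epsilon>\<close>.\<close>
  define \<rho> where "\<rho> = 1 - \<epsilon> / N"
  have eN1: "0 < \<epsilon> / N" "\<epsilon> / N < 1" using eN by (auto simp: field_simps)
  then have rho: "0 < \<rho>" "\<rho> < 1" by (auto simp: \<rho>_def)
  define G where "G = {i. i < n \<and> s i \<in> E}"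
  define H where "H = {i. i < n \<and> s i \<notin> E}"
  have GH: "{..<n} = G \<union> H" "G \<inter> H = {}" "finite G" "finite H" by (auto simp: G_def H_def)
  have cGH: "real (card G) / real n = 1 - real (card H) / real n"
  proof -
    have "n = card G + card H" using card_Un_disjoint[OF GH(3,4,2)] GH(1) by (metis card_lessThan)
    then have "real n = real (card G) + real (card H)" by (metis of_nat_add)
    then show ?thesis using n by (simp add: field_simps)
  qed
  define v where "v = real (card H) / real n"
  have v: "0 \<le> v" "N * v \<le> 2 * \<epsilon>" using few eN by (auto simp: v_def H_def field_simps)
  have est: "norm (w - (\<rho> / real n) *\<^sub>R (\<Sum>i\<in>G. \<phi> (s i))) \<le> \<epsilon> + N * (1 - \<rho> * real (card G) / real n) + 2 * \<epsilon>"
  proof (rule mcshane_sample_estimate[OF bound ga ga_sub maj g0 HK n k rho(1)])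
    show "real (card {i. i < n \<and> s i \<in> {real j / real k..real (Suc j) / real k}}) * (\<rho> / real n) \<le> 1 / real k"
      if "j < k" for j
    proof -
      let ?c = "real (card {i. i < n \<and> s i \<in> {real j / real k..real (Suc j) / real k}})"
      have "?c / real n * \<rho> \<le> 1 / (real k * \<rho>) * \<rho>"
        using bins[OF that] rho by (intro mult_right_mono) (auto simp: \<rho>_def)
      then show ?thesis using rho by simp
    qed
  qed (use s good in \<open>auto simp: G_def\<close>)
  have "\<rho> * real (card G) / real n = \<rho> * (1 - v)" unfolding v_def cGH[symmetric] by simp
  then have "N * (1 - \<rho> * real (card G) / real n) = N * (1 - \<rho> * (1 - v))" by simp
  also have "\<dots> = N * (1 - \<rho>) + \<rho> * (N * v)" by (simp add: algebra_simps)
  also have "N * (1 - \<rho>) = \<epsilon>" using eN by (simp add: \<rho>_def)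
  also have "\<rho> * (N * v) \<le> 1 * (2 * \<epsilon>)"
    using rho v eN by (intro mult_mono[of \<rho> 1 "N * v" "2 * \<epsilon>"]) auto
  finally have 1: "norm (w - (\<rho> / real n) *\<^sub>R (\<Sum>i\<in>G. \<phi> (s i))) \<le> 6 * \<epsilon>" using est by simp
  have sumg: "(\<Sum>i\<in>J. g (s i)) \<le> real n * (2 * \<epsilon>)" if "J \<subseteq> {..<n}" for J
  proof -
    have "(\<Sum>i\<in>J. g (s i)) \<le> (\<Sum>i<n. g (s i))" using that s g0 by (intro sum_mono2) auto
    also have "\<dots> \<le> real n * (2 * \<epsilon>)" using avg n by (simp add: field_simps)
    finally show ?thesis .
  qed
  have sumphi: "norm (\<Sum>i\<in>J. \<phi> (s i)) \<le> N * real (card J) + real n * (2 * \<epsilon>)" if "J \<subseteq> {..<n}" for J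
  proof -
    have "norm (\<Sum>i\<in>J. \<phi> (s i)) \<le> (\<Sum>i\<in>J. N + g (s i))" using s maj by (intro sum_norm_le) auto
    also have "\<dots> = N * real (card J) + (\<Sum>i\<in>J. g (s i))" by (simp add: sum.distrib)
    finally show ?thesis using sumg[OF that] by simp
  qed
  have "norm ((1 / real n) *\<^sub>R (\<Sum>i\<in>H. \<phi> (s i))) \<le> (1 / real n) * (N * real (card H) + real n * (2 * \<epsilon>))"
    using sumphi[of H] GH(1) by (simp add: divide_right_mono)
  also have "\<dots> = N * v + 2 * \<epsilon>" using n by (simp add: v_def field_simps)
  finally have 2: "norm ((1 / real n) *\<^sub>R (\<Sum>i\<in>H. \<phi> (s i))) \<le> 4 * \<epsilon>" using v by simp
  have "norm (((1 - \<rho>) / real n) *\<^sub>R (\<Sum>i\<in>G. \<phi> (s i))) = (1 - \<rho>) / real n * norm (\<Sum>i\<in>G. \<phi> (s i))"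
    using rho by simp
  also have "\<dots> \<le> (1 - \<rho>) / real n * (N * real n + real n * (2 * \<epsilon>))"
  proof (rule mult_left_mono)
    have "G \<subseteq> {..<n}" by (auto simp: G_def)
    then have "card G \<le> n" using card_mono[OF finite_lessThan] by force
    then have "N * real (card G) \<le> N * real n" using eN by (intro mult_left_mono) auto
    then show "norm (\<Sum>i\<in>G. \<phi> (s i)) \<le> N * real n + real n * (2 * \<epsilon>)" using sumphi[of G] GH(1) by simp
  qed (use rho in auto)
  also have "\<dots> = (1 - \<rho>) * N + 2 * \<epsilon> * (1 - \<rho>)" using n by (simp add: field_simps)
  also have "\<dots> \<le> \<epsilon> + 2 * \<epsilon> * 1" using eN rho by (intro add_mono mult_left_mono) (auto simp: \<rho>_def)
  finally have 3: "norm (((1 - \<rho>) / real n) *\<^sub>R (\<Sum>i\<in>G. \<phi> (s i))) \<le> 3 * \<epsilon>" by simp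
  \<comment> \<open>On \<open>G\<close> the weight \<open>1 / n\<close> is split into
    \<open>\<rho> / n\<close> and \<open>(1 - \<rho>) / n\<close>.\<close>
  have "w - (1 / real n) *\<^sub>R (\<Sum>i<n. \<phi> (s i)) = (w - (\<rho> / real n) *\<^sub>R (\<Sum>i\<in>G. \<phi> (s i)))
      - (1 / real n) *\<^sub>R (\<Sum>i\<in>H. \<phi> (s i)) - ((1 - \<rho>) / real n) *\<^sub>R (\<Sum>i\<in>G. \<phi> (s i))"
    using GH by (simp add: sum.union_disjoint scaleR_add_right diff_divide_distrib scaleR_diff_left)
  also have "norm \<dots> \<le> norm (w - (\<rho> / real n) *\<^sub>R (\<Sum>i\<in>G. \<phi> (s i)))
      + norm ((1 / real n) *\<^sub>R (\<Sum>i\<in>H. \<phi> (s i))) + norm (((1 - \<rho>) / real n) *\<^sub>R (\<Sum>i\<in>G. \<phi> (s i)))"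
    by (meson norm_triangle_ineq4 add_right_mono order_trans)
  finally show ?thesis using 1 2 3 by linarith
qed

section \<open>Lebesgue measure on [0,1]: integrable majorants and level sets of a gauge\<close>

lemma prob_space_lebesgue_on_01: "prob_space (lebesgue_on {0..1::real})"
  by (rule prob_spaceI) (simp add: emeasure_restrict_space)

lemma upper_integral01_finite_majorant:
  assumes "upper_integral01 g < \<infinity>"
  obtains h where "integrable (lebesgue_on {0..1}) h" "\<And>s. s \<in> {0..1} \<Longrightarrow> g s \<le> h s"
  using assms unfolding upper_integral01_def Inf_less_iff by blast

text \<open>Splits a majorant into a bounded part and an excess of small integral.\<close>

lemma integral_excess_tendsto_0:
  fixes h :: "'a \<Rightarrow> real"
  assumes "integrable M h"
  shows "(\<lambda>N. \<integral>x. max 0 (h x - real N) \<partial>M) \<longlonglongrightarrow> 0"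
proof -
  have "(\<lambda>N. \<integral>x. max 0 (h x - real N) \<partial>M) \<longlonglongrightarrow> (\<integral>x. 0 \<partial>M)"
  proof (rule integral_dominated_convergence[where w="\<lambda>x. \<bar>h x\<bar>"])
    have "eventually (\<lambda>N. max 0 (h x - real N) = 0) sequentially" for x
    proof -
      obtain n :: nat where "h x \<le> real n" using real_arch_simple by blast
      then show ?thesis unfolding eventually_sequentially by (intro exI[of _ n]) auto
    qed
    then show "AE x in M. (\<lambda>N. max 0 (h x - real N)) \<longlonglongrightarrow> 0" by (auto intro: tendsto_eventually)
  qed (use assms in auto)
  then show ?thesis by simp
qed

text \<open>The level sets increase to [0,1] because the gauge is positive, and outer measure is
  continuous along increasing sequences even of nonmeasurable sets. \<open>E\<close> is a measurable
  hull of a late one.\<close>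

lemma outer_measure_of_gauge_level_set:
  fixes \<delta> :: "real \<Rightarrow> real"
  assumes "mcshane_gauge \<delta>" and e: "0 < e"
  obtains k A E where "0 < k" "A \<subseteq> E" "E \<in> sets (lebesgue_on {0..1})"
    "\<And>t. t \<in> A \<Longrightarrow> 1 / real k \<le> \<delta> t"
    "outer_measure_of (lebesgue_on {0..1}) A = emeasure (lebesgue_on {0..1}) E"
    "1 - e < measure (lebesgue_on {0..1}) E"
proof -
  let ?M = "lebesgue_on {0..1::real}"
  interpret prob_space ?M by (rule prob_space_lebesgue_on_01)
  define A where "A = (\<lambda>m. {t \<in> {0..1}. 1 / real (Suc m) \<le> \<delta> t})"
  have "incseq A"
  proof (rule incseq_SucI)
    fix m
    have "1 / real (Suc (Suc m)) \<le> 1 / real (Suc m)" by (simp add: field_simps)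
    then show "A m \<subseteq> A (Suc m)" unfolding A_def by (auto intro: order_trans simp del: of_nat_Suc)
  qed
  have "t \<in> (\<Union>m. A m)" if t: "t \<in> {0..1}" for t
  proof -
    have "0 < \<delta> t" using assms(1) t by (simp add: mcshane_gauge_def)
    then obtain m where "inverse (real (Suc m)) < \<delta> t" using reals_Archimedean by blast
    then show ?thesis using t by (auto simp: A_def inverse_eq_divide intro!: exI[of _ m])
  qed
  then have un: "(\<Union>m. A m) = space ?M" by (auto simp: A_def)
  have "(SUP m. outer_measure_of ?M (A m)) = outer_measure_of ?M (\<Union>m. A m)"
    by (rule SUP_outer_measure_of_incseq) (use \<open>incseq A\<close> in \<open>auto simp: A_def\<close>)
  then have "(SUP m. outer_measure_of ?M (A m)) = 1" unfolding un using emeasure_space_1 by simp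
  \<comment> \<open>For \<open>e > 1\<close> the number \<open>1 - e\<close> is negative and
    \<open>ennreal\<close> truncates it to 0.\<close>
  moreover have "ennreal (1 - e) < 1" using e by (cases "0 \<le> 1 - e") (auto simp: ennreal_less_one_iff ennreal_neg)
  ultimately have "\<exists>m. ennreal (1 - e) < outer_measure_of ?M (A m)"
    by (metis less_SUP_iff UNIV_I)
  then obtain m where m: "ennreal (1 - e) < outer_measure_of ?M (A m)" ..
  have "A m \<subseteq> space ?M" by (auto simp: A_def)
  from outer_measure_of_attain[OF this] obtain E where
    E: "E \<in> sets ?M" "A m \<subseteq> E" "outer_measure_of ?M (A m) = emeasure ?M E" by blast
  have "1 - e < measure ?M E"
    using m unfolding E(3) emeasure_eq_measure by (cases "0 \<le> 1 - e") (auto simp: ennreal_less_iff intro: less_le_trans[of _ 0])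
  then show ?thesis using that[of "Suc m" "A m" E] E by (auto simp: A_def)
qed

section \<open>Talagrand integrability\<close>

text \<open>Through \<open>C\<close> the norm bound is a countable conjunction of inequalities
  between averages of the measurable functions \<open>f \<circ> \<phi>\<close>, so the event is
  measurable even if \<open>\<phi>\<close> is not.\<close>

lemma sets_averages_close:
  fixes \<phi> :: "real \<Rightarrow> 'a::real_normed_vector" and C :: "('a \<Rightarrow>\<^sub>L real) set" and M :: "real measure"
  assumes C: "countable C" "\<And>x c. norm x \<le> c \<longleftrightarrow> (\<forall>f\<in>C. blinfun_apply f x \<le> c)"
    and meas: "\<And>f :: 'a \<Rightarrow>\<^sub>L real. (\<lambda>t. blinfun_apply f (\<phi> t)) \<in> borel_measurable M"
  shows "{s \<in> space (PiM (UNIV::nat set) (\<lambda>_. M)).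
      eventually (\<lambda>n. norm (w - (1 / real n) *\<^sub>R (\<Sum>i<n. \<phi> (s i))) \<le> c) sequentially} \<in> sets (PiM UNIV (\<lambda>_. M))"
proof (rule sets_Collect_eventually_sequentially)
  fix n
  note meas[measurable]
  \<comment> \<open>An empty \<open>C\<close> would give \<open>norm 0 \<le> -1\<close>; the
    enumeration by \<open>from_nat_into\<close> relies on \<open>C\<close> being nonempty.\<close>
  have "C \<noteq> {}" using C(2)[of 0 "- 1"] by auto
  then have rg: "range (from_nat_into C) = C" using C(1) by (rule range_from_nat_into)
  have "Measurable.pred (PiM (UNIV::nat set) (\<lambda>_. M))
      (\<lambda>s. \<forall>m. blinfun_apply (from_nat_into C m) w
        - (1 / real n) * (\<Sum>i<n. blinfun_apply (from_nat_into C m) (\<phi> (s i))) \<le> c)"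
    by measurable
  then have "Measurable.pred (PiM (UNIV::nat set) (\<lambda>_. M))
      (\<lambda>s. \<forall>f\<in>range (from_nat_into C). blinfun_apply f w - (1 / real n) * (\<Sum>i<n. blinfun_apply f (\<phi> (s i))) \<le> c)"
    by simp
  then show "{s \<in> space (PiM (UNIV::nat set) (\<lambda>_. M)). norm (w - (1 / real n) *\<^sub>R (\<Sum>i<n. \<phi> (s i))) \<le> c}
      \<in> sets (PiM UNIV (\<lambda>_. M))"
    unfolding rg by (simp add: C(2) pred_def blinfun.diff_right blinfun.scaleR_right blinfun.sum_right)
qed

text \<open>For fixed \<open>e\<close> the parameters are chosen in the order \<open>N\<close>, the
  gauges, then \<open>k\<close> and \<open>E\<close>. Finitely many applications of the strong law
  then give the hypotheses of the deterministic estimate for sequences in \<open>S\<close>, and full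
  outer measure removes that restriction.\<close>

lemma AE_averages_eventually_close:
  fixes \<phi> :: "real \<Rightarrow> 'a::real_normed_vector" and C :: "('a \<Rightarrow>\<^sub>L real) set"
  assumes C: "countable C" "\<And>x c. norm x \<le> c \<longleftrightarrow> (\<forall>f\<in>C. blinfun_apply f x \<le> c)"
    and w: "has_mcshane_integral \<phi> w"
    and h: "integrable (lebesgue_on {0..1}) h" "\<And>s. s \<in> {0..1} \<Longrightarrow> norm (\<phi> s) \<le> h s"
    and e: "0 < e" "e < 1"
  shows "AE s in PiM (UNIV::nat set) (\<lambda>_. lebesgue_on {0..1}).
      eventually (\<lambda>n. norm (w - (1 / real n) *\<^sub>R (\<Sum>i<n. \<phi> (s i))) \<le> 13 * e) sequentially"
proof -
  let ?M = "lebesgue_on {0..1::real}"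
  have pM: "prob_space ?M" by (rule prob_space_lebesgue_on_01)
  interpret prob_space ?M by (rule pM)
  have meas: "(\<lambda>t. blinfun_apply f (\<phi> t)) \<in> borel_measurable ?M" for f :: "'a \<Rightarrow>\<^sub>L real"
    using mcshane_imp_has_integral[OF w] by (intro integrable_imp_measurable) (auto simp: integrable_on_def)
  have "eventually (\<lambda>N. (\<integral>x. max 0 (h x - real N) \<partial>?M) < e) sequentially"
    using integral_excess_tendsto_0[OF h(1)] e(1) by (rule order_tendstoD(2))
  then obtain N0 where N0: "\<And>N. N \<ge> N0 \<Longrightarrow> (\<integral>x. max 0 (h x - real N) \<partial>?M) < e"
    unfolding eventually_sequentially by blast
  define N where "N = real (max 1 N0)"
  define g where "g = (\<lambda>x. max 0 (h x - N))"
  have N1: "1 \<le> N" by (simp add: N_def)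
  have eN: "0 < e / N" "e / N < 1" using e N1 by (auto simp: field_simps)
  have gi: "integrable ?M g" unfolding g_def using h(1) by (intro integrable_max) auto
  have gl: "integral\<^sup>L ?M g < e" unfolding g_def N_def by (rule N0) simp
  \<comment> \<open>Lebesgue integrability implies Henstock integrability, so the sums of
    \<open>g\<close> over fine divisions are within \<open>e\<close> of an integral below
    \<open>e\<close>.\<close>
  have "(g has_integral integral\<^sup>L ?M g) {0..1}"
    using gi by (rule has_integral_integral_lebesgue_on) simp
  then obtain \<gamma>0 where ga0: "gauge \<gamma>0" and fine0: "\<And>R. R tagged_division_of {0..1} \<Longrightarrow> \<gamma>0 fine R \<Longrightarrow>
      norm ((\<Sum>(x, K)\<in>R. measure lborel K *\<^sub>R g x) - integral\<^sup>L ?M g) < e"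
    unfolding box_real(2)[symmetric] by (rule has_integralD[OF _ e(1)]) blast
  obtain \<delta> where \<delta>: "mcshane_gauge \<delta>"
    and bound: "\<And>p. mcshane_partition p \<Longrightarrow> subordinate p \<delta> \<Longrightarrow> norm (w - mcshane_sum \<phi> p) \<le> e"
    using w e(1) unfolding has_mcshane_integral_def by blast
  define \<gamma> where "\<gamma> = (\<lambda>x. \<gamma>0 x \<inter> ball x (if x \<in> {0..1} then \<delta> x else 1))"
  have ga: "gauge \<gamma>"
    unfolding \<gamma>_def using \<delta> by (intro gauge_Int ga0 gauge_ball_dependent) (auto simp: mcshane_gauge_def)
  have HK: "(\<Sum>(x, K)\<in>R. measure lborel K * g x) \<le> 2 * e" if R: "R tagged_division_of {0..1}" "\<gamma> fine R" for R
  proof -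
    have "\<gamma>0 fine R" using R(2) unfolding \<gamma>_def fine_Int by blast
    then have "norm ((\<Sum>(x, K)\<in>R. measure lborel K *\<^sub>R g x) - integral\<^sup>L ?M g) < e" by (rule fine0[OF R(1)])
    then show ?thesis using gl by (simp add: abs_less_iff)
  qed
  obtain k A E where k: "0 < k" and AE: "A \<subseteq> E" "E \<in> sets ?M" and A\<delta>: "\<And>t. t \<in> A \<Longrightarrow> 1 / real k \<le> \<delta> t"
    and om: "outer_measure_of ?M A = emeasure ?M E" and mE: "1 - e / N < measure ?M E"
    using outer_measure_of_gauge_level_set[OF \<delta> eN(1)] by metis
  \<comment> \<open>A sequence in \<open>S\<close> never meets \<open>E - A\<close>, so each sample
    in \<open>E\<close> lies in \<open>A\<close>, where \<open>\<delta>\<close> is at least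
    \<open>1/k\<close>.\<close>
  define S where "S = A \<union> (space ?M - E)"
  have S: "full_outer ?M S"
    unfolding S_def using AE om by (intro full_outer_Un_compl) (auto intro: finite_measure_axioms)
  define B where "B = (\<lambda>j::nat. {real j / real k..real (Suc j) / real k})"
  have B01: "B j \<subseteq> {0..1}" if "j < k" for j
  proof -
    have "real (Suc j) \<le> real k" using that by simp
    then have "real (Suc j) / real k \<le> 1" using k by (subst divide_le_eq_1) auto
    moreover have "0 \<le> real j / real k" by simp
    ultimately show ?thesis by (auto simp: B_def)
  qed
  have mB: "measure ?M (B j) = 1 / real k" "B j \<in> sets ?M" if "j < k" for j
  proof -
    have "B j \<in> sets lebesgue" by (simp add: B_def)
    then show "B j \<in> sets ?M" using B01[OF that] by (simp add: sets_restrict_space_iff)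
    have "measure ?M (B j) = measure lebesgue (B j)"
      using B01[OF that] by (intro measure_restrict_space) auto
    also have "\<dots> = real (Suc j) / real k - real j / real k"
      unfolding B_def by (subst measure_completion, simp, subst content_real) (auto simp: divide_right_mono)
    also have "\<dots> = 1 / real k" by (simp add: add_divide_distrib)
    finally show "measure ?M (B j) = 1 / real k" .
  qed
  have freq: "AE s in PiM (UNIV::nat set) (\<lambda>_. ?M). \<forall>c>measure ?M D.
      eventually (\<lambda>n. real (card {i. i < n \<and> s i \<in> D}) / real n < c) sequentially" if D: "D \<in> sets ?M" for D
  proof -
    have "(\<Sum>i<n. indicat_real D (s i)) = real (card {i. i < n \<and> s i \<in> D})" for n :: nat and s :: "nat \<Rightarrow> real"
    proof -
      have "(\<Sum>i<n. indicat_real D (s i)) = (\<Sum>i\<in>{i. i < n \<and> s i \<in> D}. 1)"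
        by (rule sum.mono_neutral_cong_right) (auto simp: indicator_def)
      then show ?thesis by simp
    qed
    moreover have "integrable ?M (indicat_real D)" using D by (simp add: emeasure_eq_measure)
    moreover have "integral\<^sup>L ?M (indicat_real D) = measure ?M D" using D sets.sets_into_space[OF D] by (simp add: Int_absorb2)
    ultimately show ?thesis using AE_averages_eventually_less[OF pM, of "indicat_real D"] by simp
  qed
  \<comment> \<open>Each bound strictly exceeds the mean in question, as the strong law requires:
    the complement of \<open>E\<close> has measure below \<open>e / N\<close>, each bin has measure
    \<open>1/k\<close>, and \<open>g\<close> has integral below \<open>e\<close>.\<close>
  define P where "P = (\<lambda>s. (\<forall>i. s i \<in> space ?M)
     \<and> eventually (\<lambda>n. real (card {i. i < n \<and> s i \<in> space ?M - E}) / real n < 2 * e / N) sequentially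
     \<and> (\<forall>j<k. eventually (\<lambda>n. real (card {i. i < n \<and> s i \<in> B j}) / real n < 1 / (real k * (1 - e / N))) sequentially)
     \<and> eventually (\<lambda>n. (\<Sum>i<n. g (s i)) / real n < 2 * e) sequentially)"
  have P_AE: "AE s in PiM (UNIV::nat set) (\<lambda>_. ?M). P s"
    unfolding P_def
  proof (intro AE_conjI)
    show "AE s in PiM (UNIV::nat set) (\<lambda>_. ?M). \<forall>i. s i \<in> space ?M"
      by (intro AE_I2) (auto simp: space_PiM PiE_iff)
    have "measure ?M (space ?M - E) = 1 - measure ?M E" by (rule prob_compl[OF AE(2)])
    then have small: "measure ?M (space ?M - E) < 2 * e / N" using mE eN by linarith
    have Ec: "space ?M - E \<in> sets ?M" using AE(2) by blast
    show "AE s in PiM (UNIV::nat set) (\<lambda>_. ?M).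
        eventually (\<lambda>n. real (card {i. i < n \<and> s i \<in> space ?M - E}) / real n < 2 * e / N) sequentially"
      using freq[OF Ec] by eventually_elim (use small in blast)
    have lt: "1 / real k < 1 / (real k * (1 - e / N))"
      using k eN by (intro divide_strict_left_mono) auto
    have "AE s in PiM (UNIV::nat set) (\<lambda>_. ?M). \<forall>j\<in>{..<k}.
        eventually (\<lambda>n. real (card {i. i < n \<and> s i \<in> B j}) / real n < 1 / (real k * (1 - e / N))) sequentially"
    proof (rule AE_finite_allI)
      fix j assume "j \<in> {..<k}"
      then have "j < k" by simp
      show "AE s in PiM (UNIV::nat set) (\<lambda>_. ?M).
        eventually (\<lambda>n. real (card {i. i < n \<and> s i \<in> B j}) / real n < 1 / (real k * (1 - e / N))) sequentially"
        using freq[OF mB(2)[OF \<open>j < k\<close>]] unfolding mB(1)[OF \<open>j < k\<close>]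
        by eventually_elim (use lt in blast)
    qed simp
    then show "AE s in PiM (UNIV::nat set) (\<lambda>_. ?M). \<forall>j<k.
        eventually (\<lambda>n. real (card {i. i < n \<and> s i \<in> B j}) / real n < 1 / (real k * (1 - e / N))) sequentially"
      by (simp only: Ball_def lessThan_iff)
    have less: "integral\<^sup>L ?M g < 2 * e" using gl e by simp
    show "AE s in PiM (UNIV::nat set) (\<lambda>_. ?M). eventually (\<lambda>n. (\<Sum>i<n. g (s i)) / real n < 2 * e) sequentially"
      using AE_averages_eventually_less[OF pM gi] by eventually_elim (use less in blast)
  qed
  show ?thesis
  proof (rule AE_PiM_full_outer[OF pM S P_AE sets_averages_close[OF C meas]])
    fix s assume Ps: "P s" and sS: "\<And>i. s i \<in> S"
    have s01: "s i \<in> {0..1}" for i using Ps by (simp add: P_def)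
    have "eventually (\<lambda>n. \<forall>j\<in>{..<k}. real (card {i. i < n \<and> s i \<in> B j}) / real n < 1 / (real k * (1 - e / N))) sequentially"
      using Ps by (intro eventually_ball_finite) (auto simp: P_def)
    moreover have "eventually (\<lambda>n. real (card {i. i < n \<and> s i \<in> space ?M - E}) / real n < 2 * e / N) sequentially"
      "eventually (\<lambda>n. (\<Sum>i<n. g (s i)) / real n < 2 * e) sequentially"
      using Ps by (auto simp: P_def)
    ultimately show "eventually (\<lambda>n. norm (w - (1 / real n) *\<^sub>R (\<Sum>i<n. \<phi> (s i))) \<le> 13 * e) sequentially"
      using eventually_gt_at_top[of 0]
    proof eventually_elim
      case (elim n)
      show ?case
      proof (rule mcshane_sample_mean_estimate[OF bound ga _ _ _ HK elim(4) k e N1, where E=E])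
        show "\<gamma> x \<subseteq> ball x (\<delta> x)" if "x \<in> {0..1}" for x using that by (auto simp: \<gamma>_def)
        show "norm (\<phi> x) \<le> N + g x" if "x \<in> {0..1}" for x using h(2)[OF that] by (simp add: g_def)
        show "0 \<le> g x" for x by (simp add: g_def)
        show "1 / real k \<le> \<delta> (s i)" if "s i \<in> E" for i using sS[of i] that A\<delta> by (auto simp: S_def)
        show "real (card {i. i < n \<and> s i \<notin> E}) / real n \<le> 2 * e / N"
          using elim(2) s01 by simp
        show "real (card {i. i < n \<and> s i \<in> {real j / real k..real (Suc j) / real k}}) / real n \<le> 1 / (real k * (1 - e / N))"
          if "j < k" for j
          using elim(1) that unfolding B_def by (auto intro: less_imp_le)
        show "(\<Sum>i<n. g (s i)) / real n \<le> 2 * e" using elim(3) by simp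
      qed (assumption | rule s01)+
    qed
  qed
qed

theorem mainTheorem3:
  fixes \<phi> :: "real \<Rightarrow> 'a::banach"
  assumes "weak_star_separable_dual_ball TYPE('a)"
    and "mcshane_integrable \<phi>"
    and "upper_integral01 (\<lambda>s. norm (\<phi> s)) < \<infinity>"
  shows "talagrand_integrable \<phi>"
proof -
  obtain C :: "('a \<Rightarrow>\<^sub>L real) set" where C: "countable C"
    "\<And>x c. norm x \<le> c \<longleftrightarrow> (\<forall>f\<in>C. blinfun_apply f x \<le> c)"
    using weak_star_separable_norming[OF assms(1)] by metis
  obtain w where w: "has_mcshane_integral \<phi> w" using assms(2) unfolding mcshane_integrable_def ..
  obtain h where h: "integrable (lebesgue_on {0..1}) h" "\<And>s. s \<in> {0..1} \<Longrightarrow> norm (\<phi> s) \<le> h s"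
    using upper_integral01_finite_majorant[OF assms(3)] by metis
  let ?a = "\<lambda>s n. (1 / real n) *\<^sub>R (\<Sum>i<n. \<phi> (s i))"
  \<comment> \<open>Countably many tolerances share one null set; the shift by 2 keeps
    \<open>1 / (m + 2)\<close> below 1 also for \<open>m = 0\<close>.\<close>
  have "AE s in PiM (UNIV::nat set) (\<lambda>_. lebesgue_on {0..1}). \<forall>m::nat.
      eventually (\<lambda>n. norm (w - ?a s n) \<le> 13 * (1 / real (m + 2))) sequentially"
    unfolding AE_all_countable
    by (intro allI AE_averages_eventually_close[OF C w h]) auto
  then have "AE s in PiM (UNIV::nat set) (\<lambda>_. lebesgue_on {0..1}). ?a s \<longlonglongrightarrow> w"
  proof (rule AE_mp, intro AE_I2 impI)
    fix s :: "nat \<Rightarrow> real"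
    assume *: "\<forall>m::nat. eventually (\<lambda>n. norm (w - ?a s n) \<le> 13 * (1 / real (m + 2))) sequentially"
    show "?a s \<longlonglongrightarrow> w"
    proof (rule tendstoI)
      fix r :: real assume r: "0 < r"
      obtain m :: nat where "13 / r < real m" using reals_Archimedean2 by blast
      then have "13 * (1 / real (m + 2)) < r" using r by (simp add: field_simps)
      then show "eventually (\<lambda>n. dist (?a s n) w < r) sequentially"
        using *[rule_format, of m] by (auto simp: dist_norm norm_minus_commute elim!: eventually_mono)
    qed
  qed
  then show ?thesis unfolding talagrand_integrable_def has_talagrand_integral_def by blast
qed

end
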